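(* There is a constant $C$ such that for every integer $n>0$ and every sequence $x\in 2^{(n)}$, denoting by $k$ the number of 1s in $x$, $$\left|\,D^{\mathrm{Bernoul}}(x)-\left[\log_2\binom{n}{k}-\mathit{KP}\bigl(x\mid n,k,D^{\mathrm{binom}}_{n}(k)\bigr)\right]-D^{\mathrm{binom}}_{n}(k)\,\right|\le C,$$ i.e. $D^{\mathrm{Bernoul}}(x)-\left[\log_2\binom{n}{k}-\mathit{KP}(x\mid n,k,D^{\mathrm{binom}}_{n}(k))\right]=D^{\mathrm{binom}}_{n}(k)+O(1)$. (The constant may depend on the fixed choices of universal objects made in the definitions, but not on $n$, $k$, $x$.)
   Context: Notation. $2^*$ is the set of all finite sequences of 0s and 1s; $2^{(n)}$ is the set of those of length $n$. $N=\{0,1,2,\dots\}$, $N^*$ is the set of finite sequences of natural numbers, $\mathcal F(N)$ the set of finite subsets of $N$ (a finite subset is identified with the list of its elements in increasing order). $X=2^*\cup N^*\cup N\cup\mathcal F(N)$. A condition consisting of several objects (as in $\mathit{KP}(x\mid n,k,d)$) is regarded as a single element of $X$ via a fixed computable injective encoding (integers being encoded by natural numbers). Prefix complexity. A description method is a partial computable function $B:2^*\times X\to X$. It is prefix if whenever $q\in2^*$ is a prefix of $q'\in2^*$ and $B(q,y)$ is defined, $B(q',y)$ is defined and $B(q',y)=B(q,y)$. For a description method $B$, $K_B(x\mid y)$ is the length of a shortest $q$ with $B(q,y)=x$ ($\infty$ if there is none). There is a prefix description method $A$ that is optimal: for every prefix description method $B$ there is a constant $C_B$ with $K_A(x\mid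 y)\le K_B(x\mid y)+C_B$ for all $x,y\in X$. Fix one such $A$; $\mathit{KP}(x\mid y):=K_A(x\mid y)$ is the prefix complexity of $x$ given $y$. Measures. For $p\in[0,1]$ and integer $n>0$, the Bernoulli measure with parameters $(n,p)$ on $2^{(n)}$ is $P\{x\}=p^k(1-p)^{n-k}$, where $k$ is the number of 1s in $x$; the binomial measure with parameters $(n,p)$ on $\{0,1,\dots,n\}$ is $P\{k\}=\binom nk p^k(1-p)^{n-k}$. Tests and deficiencies. A test (for Bernoulli measures, respectively for binomial measures) is a function $T(x\mid P)$ with values in $\mathbb Z\cup\{+\infty\}$, where $P$ ranges over all Bernoulli (respectively binomial) measures with parameters $(n,p)$, $n>0$, $p\in[0,1]$, and $x\in2^{(n)}$ (respectively $x\in\{0,\dots,n\}$), such that: (1) $E\,2^{T(x\mid P)}\le1$, where $E$ is the mean under $P$ (terms with $P\{x\}=0$ contribute 0); (2) $T$ is lower semicomputable: there is an algorithm that, given $n$, $x$ and any oracle that for each $i\in N$ outputs a rational $a_i$ with $|a_i-p|\le2^{-i}$ (the sequence $a_i$ need not be computable), enumerates a nondecreasing sequence of integers $m_j$ with $\sup_j m_j=T(x\mid P)$, and it works correctly for every such oracle. There is a universal test $D(x\mid P)$: for every test $T$ there is a constant $C_T$ with $D(x\mid P)\ge T(x\mid P)-C_T$ for all $x,P$. Fix such a $D$ for Bernoulli measures and for binomial measures; $D(x\mid P)$ is the randomness deficiency of $x$ with respect to $P$. For $x\in2^{(n)}$, $D^{\mathrm{Bernoul}}(x):=\inf D(x\mid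 P)$, the infimum being over the Bernoulli measures $P$ with parameters $(n,p)$, $p\in[0,1]$. For $k\in\{0,\dots,n\}$, $D^{\mathrm{binom}}_{n}(k):=\inf D(k\mid P)$, the infimum being over the binomial measures $P$ with parameters $(n,p)$, $p\in[0,1]$. *)

theory Defs
  imports
    "HOL-Probability.Probability"
    "HOL-Library.Nat_Bijection"
    "HOL-Library.Sublist"
begin

text \<open>
  Programs for the functions that are partial recursive relative to an oracle, in the unary
  presentation where tuples are coded by \<^const>\<open>prod_encode\<close>.
  \<open>PRec\<close> is primitive recursion and \<open>Mu\<close> is unbounded minimisation, which
  diverges if the function being searched diverges before its first zero.
\<close>

datatype prog =
    Zero | Succ | Fst | Snd | Query
  | Tup prog prog | Comp prog prog | PRec prog prog | Mu prog

primrec run :: "prog \<Rightarrow> (nat \<Rightarrow> nat) \<Rightarrow> nat \<Rightarrow> nat option" where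
  "run Zero h x = Some 0"
| "run Succ h x = Some (Suc x)"
| "run Fst h x = Some (fst (prod_decode x))"
| "run Snd h x = Some (snd (prod_decode x))"
| "run Query h x = Some (h x)"
| "run (Tup f g) h x =
     Option.bind (run f h x) (\<lambda>a. Option.bind (run g h x) (\<lambda>b. Some (prod_encode (a, b))))"
| "run (Comp f g) h x = Option.bind (run g h x) (run f h)"
| "run (PRec f g) h x =
     (case prod_decode x of (a, m) \<Rightarrow>
        rec_nat (run f h a)
          (\<lambda>i r. Option.bind r (\<lambda>v. run g h (prod_encode (a, prod_encode (i, v))))) m)"
| "run (Mu f) h x =
     (if \<exists>m. run f h (prod_encode (x, m)) = Some 0 \<and>
             (\<forall>i<m. run f h (prod_encode (x, i)) \<noteq> None)
      then Some (LEAST m. run f h (prod_encode (x, m)) = Some 0)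
      else None)"

definition partial_computable :: "(nat \<Rightarrow> nat option) \<Rightarrow> bool" where
  "partial_computable f \<longleftrightarrow> (\<exists>c. \<forall>x. run c (\<lambda>_. 0) x = f x)"

text \<open>
  The set \<open>X\<close> of binary words, finite sequences of natural numbers, natural numbers and
  finite sets of natural numbers, as a tagged union. A finite set is identified with the increasing
  list of its elements, so it needs no constructor besides \<open>NatSeq\<close>.
\<close>

datatype obj = Word "bool list" | NatSeq "nat list" | Num nat

definition encode_word :: "bool list \<Rightarrow> nat" where
  "encode_word q = list_encode (map of_bool q)"

fun encode_obj :: "obj \<Rightarrow> nat" where
  "encode_obj (Word q) = prod_encode (0, encode_word q)"
| "encode_obj (NatSeq l) = prod_encode (1, list_encode l)"
| "encode_obj (Num n) = prod_encode (2, n)"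

type_synonym method_fun = "bool list \<Rightarrow> obj \<Rightarrow> obj option"

definition description_method :: "method_fun \<Rightarrow> bool" where
  "description_method B \<longleftrightarrow>
     (\<exists>f. partial_computable f \<and>
        (\<forall>q y. f (prod_encode (encode_word q, encode_obj y)) = map_option encode_obj (B q y)))"

definition prefix_method :: "method_fun \<Rightarrow> bool" where
  "prefix_method B \<longleftrightarrow> description_method B \<and>
     (\<forall>q q' y x. prefix q q' \<longrightarrow> B q y = Some x \<longrightarrow> B q' y = Some x)"

text \<open>The infimum of the empty set is \<^term>\<open>\<infinity> :: enat\<close>.\<close>

definition complexity :: "method_fun \<Rightarrow> obj \<Rightarrow> obj \<Rightarrow> enat" where
  "complexity B x y = (INF q\<in>{q. B q y = Some x}. enat (length q))"

definition optimal_prefix_method :: "method_fun \<Rightarrow> bool" where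
  "optimal_prefix_method A \<longleftrightarrow> prefix_method A \<and>
     (\<forall>B. prefix_method B \<longrightarrow>
        (\<exists>C::nat. \<forall>x y. complexity A x y \<le> complexity B x y + enat C))"

definition bernoulli_measure :: "nat \<Rightarrow> real \<Rightarrow> bool list pmf" where
  "bernoulli_measure n p = replicate_pmf n (bernoulli_pmf p)"

lemma pmf_bernoulli_measure:
  assumes "p \<in> {0..1}" "length x = n"
  shows "pmf (bernoulli_measure n p) x
           = p ^ count_list x True * (1 - p) ^ (n - count_list x True)"
  using assms(2) unfolding bernoulli_measure_def
proof (induction n arbitrary: x)
  case 0
  then show ?case by simp
next
  case (Suc n)
  then obtain a y where x: "x = a # y" and y: "length y = n"
    by (cases x) auto
  let ?R = "replicate_pmf n (bernoulli_pmf p)"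
  have le: "count_list y True \<le> n"
    using y count_le_length by metis
  have "replicate_pmf (Suc n) (bernoulli_pmf p)
          = map_pmf (\<lambda>(a, y). a # y) (pair_pmf (bernoulli_pmf p) ?R)"
    by (simp add: pair_pmf_def map_bind_pmf)
  moreover have "pmf (map_pmf (\<lambda>(a, y). a # y) (pair_pmf (bernoulli_pmf p) ?R))
                   ((\<lambda>(a, y). a # y) (a, y)) = pmf (pair_pmf (bernoulli_pmf p) ?R) (a, y)"
    by (rule pmf_map_inj') (auto intro: injI)
  ultimately have "pmf (replicate_pmf (Suc n) (bernoulli_pmf p)) x
                     = pmf (bernoulli_pmf p) a * pmf ?R y"
    by (simp add: x pmf_pair)
  then show ?case
    using Suc.IH[OF y] assms(1) le by (cases a) (auto simp: x Suc_diff_le)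
qed

text \<open>
  The two families of measures are treated uniformly: \<open>S n\<close> is the sample space,
  \<open>M n p\<close> the measure with parameters \<open>(n, p)\<close>, and \<open>e\<close> codes
  outcomes by natural numbers. A test takes the parameters of the measure rather than a pmf, since
  \<^term>\<open>binomial_pmf n 0\<close> is the same pmf on \<^typ>\<open>nat\<close> for all \<open>n\<close>,
  whereas the binomial measures on the different spaces \<open>{0..n}\<close> are distinct.
  Only \<open>n > 0\<close>, \<open>p \<in> {0..1}\<close> and \<open>x \<in> S n\<close> matter.
\<close>

type_synonym 'a test = "nat \<Rightarrow> real \<Rightarrow> 'a \<Rightarrow> ereal"

definition exp2 :: "ereal \<Rightarrow> ennreal" where
  "exp2 t = (case t of ereal r \<Rightarrow> ennreal (2 powr r) | PInfty \<Rightarrow> \<infinity> | MInfty \<Rightarrow> 0)"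

definition encode_rat :: "rat \<Rightarrow> nat" where
  "encode_rat r = (case quotient_of r of (a, b) \<Rightarrow> prod_encode (int_encode a, int_encode b))"

definition approximates :: "(nat \<Rightarrow> rat) \<Rightarrow> real \<Rightarrow> bool" where
  "approximates a p \<longleftrightarrow> (\<forall>i. \<bar>of_rat (a i) - p\<bar> \<le> 1 / 2 ^ i)"

text \<open>
  The enumeration \<open>m\<close> is indexed by all of \<^typ>\<open>nat\<close> and may be eventually
  constant; it may depend on the oracle \<open>a\<close>, but its supremum may not.
\<close>

definition lower_semicomputable ::
  "(nat \<Rightarrow> 'a set) \<Rightarrow> ('a \<Rightarrow> nat) \<Rightarrow> 'a test \<Rightarrow> bool" where
  "lower_semicomputable S e T \<longleftrightarrow>
     (\<exists>c. \<forall>n>0. \<forall>p\<in>{0..1}. \<forall>x\<in>S n. \<forall>a. approximates a p \<longrightarrow>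
        (\<exists>m :: nat \<Rightarrow> int. mono m \<and>
           (\<forall>j. run c (\<lambda>i. encode_rat (a i)) (prod_encode (n, prod_encode (e x, j)))
                  = Some (int_encode (m j))) \<and>
           (SUP j. ereal (of_int (m j))) = T n p x))"

definition is_test ::
  "(nat \<Rightarrow> 'a set) \<Rightarrow> (nat \<Rightarrow> real \<Rightarrow> 'a pmf) \<Rightarrow> ('a \<Rightarrow> nat) \<Rightarrow> 'a test \<Rightarrow> bool" where
  "is_test S M e T \<longleftrightarrow>
     (\<forall>n>0. \<forall>p\<in>{0..1}. \<forall>x\<in>S n. T n p x \<in> insert \<infinity> (range (\<lambda>z::int. ereal (of_int z)))) \<and>
     (\<forall>n>0. \<forall>p\<in>{0..1}. (\<integral>\<^sup>+x. exp2 (T n p x) \<partial>measure_pmf (M n p)) \<le> 1) \<and>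
     lower_semicomputable S e T"

definition universal_test ::
  "(nat \<Rightarrow> 'a set) \<Rightarrow> (nat \<Rightarrow> real \<Rightarrow> 'a pmf) \<Rightarrow> ('a \<Rightarrow> nat) \<Rightarrow> 'a test \<Rightarrow> bool" where
  "universal_test S M e D \<longleftrightarrow> is_test S M e D \<and>
     (\<forall>T. is_test S M e T \<longrightarrow>
        (\<exists>C::real. \<forall>n>0. \<forall>p\<in>{0..1}. \<forall>x\<in>S n. D n p x \<ge> T n p x - ereal C))"

definition universal_bernoulli_test :: "bool list test \<Rightarrow> bool" where
  "universal_bernoulli_test =
     universal_test (\<lambda>n. {x. length x = n}) bernoulli_measure encode_word"

definition universal_binomial_test :: "nat test \<Rightarrow> bool" where
  "universal_binomial_test = universal_test (\<lambda>n. {0..n}) binomial_pmf (\<lambda>k. k)"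

definition bernoulli_deficiency :: "bool list test \<Rightarrow> bool list \<Rightarrow> ereal" where
  "bernoulli_deficiency D x = (INF p\<in>{0..1}. D (length x) p x)"

definition binomial_deficiency :: "nat test \<Rightarrow> nat \<Rightarrow> nat \<Rightarrow> ereal" where
  "binomial_deficiency D n k = (INF p\<in>{0..1}. D n p k)"

text \<open>
  The condition \<open>n, k, d\<close> as one object. The deficiency \<open>d\<close> is an integer-valued
  \<^typ>\<open>ereal\<close>, so the floor is only a conversion to \<^typ>\<open>int\<close>.
  For an infinite \<open>d\<close> the value is junk; a finite bound on the absolute value of an
  \<^typ>\<open>ereal\<close> difference involving \<open>d\<close> excludes that case.
\<close>

definition condition_obj :: "nat \<Rightarrow> nat \<Rightarrow> ereal \<Rightarrow> obj" where
  "condition_obj n k d = NatSeq [n, k, int_encode \<lfloor>real_of_ereal d\<rfloor>]"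

end

theory Submission
  imports Defs
begin

text \<open>
  Let \<open>d(k)\<close> and \<open>D(x)\<close> denote the infima over the parameter \<open>p\<close> of the two universal
  tests. The proof first removes \<open>p\<close>. Every \<open>p\<close> in the unit interval is approximated by an oracle
  that follows a branch of the binary tree of dyadic intervals, and every branch is such an oracle.
  An integer is a lower bound for the infimum exactly if on each branch a finite part of the oracle
  suffices to confirm it, and then, by compactness of the space of branches, one finite level of the
  tree confirms it on all branches at once (\<open>inf_over_parameter_enumerable\<close>). Hence
  \<open>d\<close> and \<open>D\<close> are limits of nondecreasing stages that are computable without an oracle.
  They are finite because each outcome has positive probability for some \<open>p\<close>, and bounded below
  because \<open>0\<close> is a test; a constant shift makes all stages natural numbers. Each half of the
  theorem now comes from one test that does not depend on \<open>p\<close>.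

  Lower bound for \<open>D(x)\<close>. Let \<open>T(x)\<close> be the largest value of
  \<open>j + log (n choose k) - |q|\<close>, where \<open>j \<le> d(k)\<close> and \<open>q\<close> is a program for
  \<open>x\<close> given \<open>n, k, j\<close>. Among the words with \<open>k\<close> ones the mean of \<open>2 ^ T(x)\<close> is, by
  Kraft's inequality for each \<open>j\<close>, at most the sum of \<open>2 ^ j\<close> over \<open>j \<le> d(k)\<close>,
  which is less than \<open>2 * 2 ^ d(k)\<close>; and \<open>2 ^ d(k)\<close> has bounded mean under every binomial
  measure. So \<open>T\<close> is a Bernoulli test up to a constant (\<open>described_words_test\<close>), and
  \<open>D(x)\<close> exceeds \<open>T(x)\<close>, in particular its value for \<open>j = d(k)\<close>, up to a constant.
  All \<open>j \<le> d(k)\<close> have to be admitted because \<open>d(k)\<close> is only known from below.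

  Upper bound for \<open>D(x)\<close>. The logarithm of the average of \<open>2 ^ D(x)\<close> over the words with
  \<open>k\<close> ones is a binomial test (\<open>averaged_weights_test\<close>), hence at most
  \<open>d(k) + O(1)\<close>. Therefore, for a suitable constant, the numbers
  \<open>2 ^ D(x) / (2 ^ (d(k) + O(1)) * (n choose k))\<close> have sum at most 1. They are approximated from
  below by a computation that knows \<open>n\<close>, \<open>k\<close> and \<open>d(k)\<close>, so disjoint subintervals of
  the unit interval can be allocated to the words as the approximations grow, and a word is described
  by a dyadic interval inside one of its subintervals (\<open>interval_coding\<close>,
  \<open>complexity_le_of_summable_stages\<close>). The length of this description is
  \<open>log (n choose k) + d(k) - D(x) + O(1)\<close>.
\<close>

section \<open>Computable total functions\<close>

abbreviation pfst :: "nat \<Rightarrow> nat" where "pfst z \<equiv> fst (prod_decode z)"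
abbreviation psnd :: "nat \<Rightarrow> nat" where "psnd z \<equiv> snd (prod_decode z)"

text \<open>
  The program has to give the same results with every oracle: functions of this kind are used both as
  parts of tests, which run with an oracle for the parameter, and as parts of description methods,
  which run with the zero oracle.
\<close>

definition computable :: "(nat \<Rightarrow> nat) \<Rightarrow> bool" where
  "computable f \<longleftrightarrow> (\<exists>c. \<forall>h x. run c h x = Some (f x))"

definition decidable :: "(nat \<Rightarrow> bool) \<Rightarrow> bool" where
  "decidable P \<longleftrightarrow> computable (\<lambda>x. of_bool (P x))"

named_theorems computable_intros

lemma computableI: "(\<And>h x. run c h x = Some (f x)) \<Longrightarrow> computable f"
  unfolding computable_def by blast

lemma computable_comp:
  assumes "computable f" "computable g"
  shows "computable (\<lambda>x. f (g x))"
proof -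
  obtain c d where "\<And>h x. run c h x = Some (f x)" "\<And>h x. run d h x = Some (g x)"
    using assms unfolding computable_def by blast
  then show ?thesis
    by (intro computableI[of "Comp c d"]) simp
qed

lemma computable_id [computable_intros]: "computable (\<lambda>x. x)"
  by (intro computableI[of "Tup Fst Snd"]) simp

lemma computable_Suc [computable_intros]: "computable f \<Longrightarrow> computable (\<lambda>x. Suc (f x))"
  by (rule computable_comp[of Suc]) (auto intro: computableI[of Succ])

lemma computable_const [computable_intros]: "computable (\<lambda>_. k)"
  by (induction k) (auto intro: computableI[of Zero] computable_Suc)

lemma computable_pfst [computable_intros]: "computable f \<Longrightarrow> computable (\<lambda>x. pfst (f x))"
  by (rule computable_comp[of pfst]) (auto intro: computableI[of Fst])

lemma computable_psnd [computable_intros]: "computable f \<Longrightarrow> computable (\<lambda>x. psnd (f x))"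
  by (rule computable_comp[of psnd]) (auto intro: computableI[of Snd])

lemma computable_pair [computable_intros]:
  assumes "computable f" "computable g"
  shows "computable (\<lambda>x. prod_encode (f x, g x))"
proof -
  obtain c d where "\<And>h x. run c h x = Some (f x)" "\<And>h x. run d h x = Some (g x)"
    using assms unfolding computable_def by blast
  then show ?thesis
    by (intro computableI[of "Tup c d"]) simp
qed

lemma computable_comp2:
  assumes "computable (\<lambda>z. f (pfst z) (psnd z))" "computable a" "computable b"
  shows "computable (\<lambda>x. f (a x) (b x))"
  using computable_comp[OF assms(1) computable_pair[OF assms(2,3)]] by simp

lemma computable_comp3:
  assumes "computable (\<lambda>z. f (pfst z) (pfst (psnd z)) (psnd (psnd z)))"
    "computable a" "computable b" "computable c"
  shows "computable (\<lambda>x. f (a x) (b x) (c x))"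
  using computable_comp[OF assms(1) computable_pair[OF assms(2) computable_pair[OF assms(3,4)]]]
  by simp

text \<open>
  Rules of this shape let the proof method \<open>intro\<close> establish computability by following the
  syntax of a term. A parameter under a binder turns into a projection of the argument.
\<close>

lemma computable_rec [computable_intros]:
  assumes "computable f" "computable (\<lambda>z. g (pfst z) (pfst (psnd z)) (psnd (psnd z)))"
    "computable n"
  shows "computable (\<lambda>x. rec_nat (f x) (\<lambda>i r. g x i r) (n x))"
proof -
  obtain c d e where
    "\<And>h x. run c h x = Some (f x)" and
    "\<And>h z. run d h z = Some (g (pfst z) (pfst (psnd z)) (psnd (psnd z)))" and
    "\<And>h x. run e h x = Some (n x)"
    using assms unfolding computable_def by blast
  moreover have "rec_nat (Some (f x)) (\<lambda>i r. Option.bind r (\<lambda>v. Some (g x i v))) m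
      = Some (rec_nat (f x) (\<lambda>i r. g x i r) m)" for x m
    by (induction m) auto
  ultimately show ?thesis
    by (intro computableI[of "Comp (PRec c d) (Tup (Tup Fst Snd) e)"]) simp
qed

lemma computable_add [computable_intros]:
  assumes "computable f" "computable g"
  shows "computable (\<lambda>x. f x + g x)"
proof -
  have "computable (\<lambda>x. rec_nat (f x) (\<lambda>i r. Suc r) (g x))"
    by (intro computable_intros assms)
  moreover have "rec_nat a (\<lambda>i r. Suc r) b = a + b" for a b
    by (induction b) auto
  ultimately show ?thesis by simp
qed

text \<open>
  Bounded sums are the main tool: bounded quantifiers, division and counting reduce to them.
\<close>

lemma computable_sum [computable_intros]:
  assumes "computable (\<lambda>z. g (pfst z) (psnd z))" "computable n"
  shows "computable (\<lambda>x. \<Sum>i<n x. g x i)"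
proof -
  have "computable (\<lambda>x. rec_nat 0 (\<lambda>i r. r + g x i) (n x))"
    by (intro computable_intros computable_comp2[OF assms(1)] assms(2))
  moreover have "rec_nat 0 (\<lambda>i r. r + g x i) m = (\<Sum>i<m. g x i)" for x m
    by (induction m) auto
  ultimately show ?thesis by simp
qed

lemma computable_mult [computable_intros]:
  assumes "computable f" "computable g"
  shows "computable (\<lambda>x. f x * g x :: nat)"
proof -
  have "computable (\<lambda>x. \<Sum>i<g x. f x)"
    by (intro computable_intros assms assms(1)[THEN computable_comp])
  then show ?thesis by (simp add: mult.commute)
qed

lemma computable_diff [computable_intros]:
  assumes "computable f" "computable g"
  shows "computable (\<lambda>x. f x - g x :: nat)"
proof -
  have "computable (\<lambda>x. rec_nat 0 (\<lambda>i r. i) (f x))" if "computable f" for f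
    by (intro computable_intros that)
  moreover have "rec_nat 0 (\<lambda>i r. i) b = b - 1" for b
    by (cases b) auto
  ultimately have pred: "computable (\<lambda>x. f x - 1)" if "computable f" for f
    using that by simp
  have "computable (\<lambda>x. rec_nat (f x) (\<lambda>i r. r - 1) (g x))"
    by (intro computable_intros pred assms)
  moreover have "rec_nat a (\<lambda>i r. r - 1) b = a - b" for a b :: nat
    by (induction b) auto
  ultimately show ?thesis by simp
qed

lemma computable_power [computable_intros]:
  assumes "computable f" "computable g"
  shows "computable (\<lambda>x. f x ^ g x)"
proof -
  have "computable (\<lambda>x. rec_nat 1 (\<lambda>i r. f x * r) (g x))"
    by (intro computable_intros assms assms(1)[THEN computable_comp])
  moreover have "rec_nat 1 (\<lambda>i r. a * r) b = a ^ b" for a b :: nat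
    by (induction b) auto
  ultimately show ?thesis by simp
qed

lemma computable_if [computable_intros]:
  assumes "decidable P" "computable f" "computable g"
  shows "computable (\<lambda>x. if P x then f x else g x)"
proof -
  have "computable (\<lambda>x. rec_nat (g x) (\<lambda>_ _. f x) (of_bool (P x)))"
    by (intro computable_intros assms assms(1)[unfolded decidable_def]
        computable_comp[OF assms(2)])
  then show ?thesis
    by (rule back_subst[of computable]) auto
qed

lemma decidable_eq0 [computable_intros]:
  assumes "computable f"
  shows "decidable (\<lambda>x. f x = 0)"
proof -
  have "computable (\<lambda>x. 1 - f x)"
    by (intro computable_intros assms)
  moreover have "1 - f x = of_bool (f x = 0)" for x by auto
  ultimately show ?thesis by (simp add: decidable_def)
qed

lemma decidable_not [computable_intros]:
  assumes "decidable P"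
  shows "decidable (\<lambda>x. \<not> P x)"
  using decidable_eq0[OF assms[unfolded decidable_def]] by simp

lemma decidable_conj [computable_intros]:
  assumes "decidable P" "decidable Q"
  shows "decidable (\<lambda>x. P x \<and> Q x)"
  using computable_mult[OF assms[unfolded decidable_def]]
  by (simp add: decidable_def of_bool_conj)

lemma decidable_disj [computable_intros]:
  assumes "decidable P" "decidable Q"
  shows "decidable (\<lambda>x. P x \<or> Q x)"
  using decidable_not[OF decidable_conj[OF assms[THEN decidable_not]]] by simp

lemma decidable_le [computable_intros]:
  assumes "computable f" "computable g"
  shows "decidable (\<lambda>x. f x \<le> g x)"
  using decidable_eq0[OF computable_diff[OF assms]] by simp

lemma decidable_less [computable_intros]:
  assumes "computable f" "computable g"
  shows "decidable (\<lambda>x. f x < g x)"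
  using decidable_not[OF decidable_le[OF assms(2,1)]] by (simp add: not_le)

lemma decidable_eq [computable_intros]:
  assumes "computable f" "computable g"
  shows "decidable (\<lambda>x. f x = g x)"
  using decidable_conj[OF decidable_le[OF assms] decidable_le[OF assms(2,1)]]
  by (simp add: eq_iff)

lemma decidable_ex [computable_intros]:
  assumes "decidable (\<lambda>z. P (pfst z) (psnd z))" "computable n"
  shows "decidable (\<lambda>x. \<exists>i<n x. P x i)"
proof -
  have "decidable (\<lambda>x. \<not> (\<Sum>i<n x. of_bool (P x i) :: nat) = 0)"
    by (intro computable_intros assms assms(1)[unfolded decidable_def])
  then show ?thesis by (rule back_subst[of decidable]) auto
qed

lemma decidable_all [computable_intros]:
  assumes "decidable (\<lambda>z. P (pfst z) (psnd z))" "computable n"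
  shows "decidable (\<lambda>x. \<forall>i<n x. P x i)"
proof -
  have "decidable (\<lambda>x. \<not> (\<exists>i<n x. \<not> P x i))"
    by (intro computable_intros assms)
  then show ?thesis by simp
qed

lemma computable_div [computable_intros]:
  assumes "computable f" "computable g"
  shows "computable (\<lambda>x. f x div g x)"
proof -
  have "computable (\<lambda>x. \<Sum>j<f x. if Suc j * g x \<le> f x \<and> 0 < g x then 1 else 0)"
    by (intro computable_intros assms assms[THEN computable_comp])
  moreover have "(\<Sum>j<a. if Suc j * b \<le> a \<and> 0 < b then 1 else 0) = a div b" for a b :: nat
  proof (cases "b = 0")
    case False
    have "(\<Sum>j<a. if Suc j * b \<le> a \<and> 0 < b then 1 else 0)
        = (\<Sum>j\<in>{j\<in>{..<a}. Suc j * b \<le> a \<and> 0 < b}. 1)"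
      by (subst sum.inter_filter[symmetric]) auto
    also have "{j\<in>{..<a}. Suc j * b \<le> a \<and> 0 < b} = {..<a div b}"
    proof -
      have "Suc j * b \<le> a \<longleftrightarrow> j < a div b" for j
        using False less_eq_div_iff_mult_less_eq[of b "Suc j" a] by (simp add: Suc_le_eq)
      moreover have "j < a div b \<Longrightarrow> j < a" for j
        using div_le_dividend[of a b] by linarith
      ultimately show ?thesis using False by auto
    qed
    also have "(\<Sum>j<a div b. 1) = a div b" by simp
    finally show ?thesis .
  qed simp
  ultimately show ?thesis by simp
qed

lemma computable_mod [computable_intros]:
  assumes "computable f" "computable g"
  shows "computable (\<lambda>x. f x mod g x)"
proof -
  have "computable (\<lambda>x. f x - g x * (f x div g x))"
    by (intro computable_intros assms)
  then show ?thesis by (simp only: minus_mult_div_eq_mod)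
qed

lemma decidable_odd [computable_intros]:
  assumes "computable f"
  shows "decidable (\<lambda>x. odd (f x))"
proof -
  have "decidable (\<lambda>x. \<not> f x = 2 * (f x div 2))"
    by (intro computable_intros assms)
  moreover have "(\<not> n = 2 * (n div 2)) = odd n" for n :: nat
    by presburger
  ultimately show ?thesis by simp
qed

lemma computable_of_bool [computable_intros]:
  "decidable P \<Longrightarrow> computable (\<lambda>x. of_bool (P x))"
  by (simp add: decidable_def)

section \<open>Evaluation with bounded fuel and a finite part of the oracle\<close>

text \<open>
  \<open>fuel_run Q c b s x\<close> runs \<open>c\<close> on \<open>x\<close> and gives \<open>Suc y\<close> if the fuel \<open>s\<close>
  suffices to find the value \<open>y\<close>, and 0 otherwise. The function \<open>Q b s\<close> is the part of the
  oracle known at stage \<open>s\<close>, in the same coding; \<open>b\<close> names that part. Fuel limits the oracle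
  and the range of unbounded searches, which makes the function total.
\<close>

primrec fuel_run :: "(nat \<Rightarrow> nat \<Rightarrow> nat \<Rightarrow> nat) \<Rightarrow> prog \<Rightarrow> nat \<Rightarrow> nat \<Rightarrow> nat \<Rightarrow> nat" where
  "fuel_run Q Zero b s x = 1"
| "fuel_run Q Succ b s x = Suc (Suc x)"
| "fuel_run Q Fst b s x = Suc (pfst x)"
| "fuel_run Q Snd b s x = Suc (psnd x)"
| "fuel_run Q Query b s x = Q b s x"
| "fuel_run Q (Tup f g) b s x =
     (if fuel_run Q f b s x = 0 \<or> fuel_run Q g b s x = 0 then 0
      else Suc (prod_encode (fuel_run Q f b s x - 1, fuel_run Q g b s x - 1)))"
| "fuel_run Q (Comp f g) b s x =
     (if fuel_run Q g b s x = 0 then 0 else fuel_run Q f b s (fuel_run Q g b s x - 1))"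
| "fuel_run Q (PRec f g) b s x =
     rec_nat (fuel_run Q f b s (pfst x))
       (\<lambda>i r. if r = 0 then 0 else fuel_run Q g b s (prod_encode (pfst x, prod_encode (i, r - 1))))
       (psnd x)"
| "fuel_run Q (Mu f) b s x =
     (\<Sum>m<s. if fuel_run Q f b s (prod_encode (x, m)) = 1 \<and>
               (\<forall>i<m. 1 < fuel_run Q f b s (prod_encode (x, i)))
            then Suc m else 0)"

text \<open>
  Since \<open>c\<close> is fixed, induction on \<open>c\<close> does the work of a universal program.
\<close>

lemma computable_fuel_run:
  assumes "computable (\<lambda>z. Q (pfst z) (pfst (psnd z)) (psnd (psnd z)))"
    and "computable b" "computable s" "computable x"
  shows "computable (\<lambda>z. fuel_run Q c (b z) (s z) (x z))"
  using assms(2-)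
proof (induction c arbitrary: b s x)
  case Query
  then show ?case by (simp add: computable_comp3[of Q, OF assms(1)])
next
  case (Tup f g)
  show ?case unfolding fuel_run.simps
    by (intro computable_intros Tup)
next
  case (Comp f g)
  show ?case unfolding fuel_run.simps
    by (intro computable_intros Comp)
next
  case (PRec f g)
  show ?case unfolding fuel_run.simps
    by (intro computable_intros PRec PRec(3-5)[THEN computable_comp])
next
  case (Mu f)
  show ?case unfolding fuel_run.simps
    by (intro computable_intros Mu Mu(2-4)[THEN computable_comp])
qed (auto intro!: computable_intros)

lemma fuel_run_Mu_eq_Suc_iff:
  "fuel_run Q (Mu f) b s x = Suc y \<longleftrightarrow> y < s \<and>
     fuel_run Q f b s (prod_encode (x, y)) = 1 \<and> (\<forall>i<y. 1 < fuel_run Q f b s (prod_encode (x, i)))"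
proof -
  define P where "P = (\<lambda>m. fuel_run Q f b s (prod_encode (x, m)) = 1 \<and>
    (\<forall>i<m. 1 < fuel_run Q f b s (prod_encode (x, i))))"
  have unique: "m = m'" if "P m" "P m'" for m m'
    using that unfolding P_def by (metis less_irrefl linorder_neqE_nat)
  have eq: "(\<Sum>m<s. if P m then Suc m else 0) = Suc y" if "P y" "y < s" for y
  proof -
    have "(\<Sum>m<s. if P m then Suc m else 0) = (\<Sum>m<s. if m = y then Suc y else 0)"
      using unique that by (intro sum.cong) auto
    also have "\<dots> = Suc y" using that by (subst sum.delta) auto
    finally show ?thesis .
  qed
  have "\<exists>m<s. P m" if "(\<Sum>m<s. if P m then Suc m else 0) = Suc y"
  proof (rule ccontr)
    assume "\<not> (\<exists>m<s. P m)"
    then have "(\<Sum>m<s. if P m then Suc m else 0) = 0" by (intro sum.neutral) auto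
    with that show False by simp
  qed
  then have "(\<Sum>m<s. if P m then Suc m else 0) = Suc y \<longleftrightarrow> y < s \<and> P y"
    using eq by (metis Suc_inject)
  then show ?thesis by (simp add: P_def)
qed

lemma run_Mu_eq_Some_iff:
  "run (Mu f) h x = Some y \<longleftrightarrow>
     run f h (prod_encode (x, y)) = Some 0 \<and> (\<forall>i<y. \<exists>v. run f h (prod_encode (x, i)) = Some (Suc v))"
  (is "?L \<longleftrightarrow> ?R")
proof
  assume ?L
  then have ex: "\<exists>m. run f h (prod_encode (x, m)) = Some 0 \<and>
      (\<forall>i<m. run f h (prod_encode (x, i)) \<noteq> None)"
    and y: "y = (LEAST m. run f h (prod_encode (x, m)) = Some 0)"
    by (auto split: if_splits)
  from ex obtain m where m: "run f h (prod_encode (x, m)) = Some 0"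
    "\<forall>i<m. run f h (prod_encode (x, i)) \<noteq> None" by blast
  have "run f h (prod_encode (x, y)) = Some 0"
    unfolding y using m(1) by (rule LeastI)
  moreover have "y \<le> m" unfolding y using m(1) by (rule Least_le)
  moreover have "run f h (prod_encode (x, i)) \<noteq> Some 0" if "i < y" for i
    using that not_less_Least unfolding y by blast
  ultimately show ?R using m(2)
    by (metis not0_implies_Suc option.exhaust order_less_le_trans)
next
  assume R: ?R
  then have "(LEAST m. run f h (prod_encode (x, m)) = Some 0) = y"
    by (intro Least_equality) (auto simp: not_le[symmetric] dest: leI)
  moreover have "\<exists>m. run f h (prod_encode (x, m)) = Some 0 \<and>
      (\<forall>i<m. run f h (prod_encode (x, i)) \<noteq> None)"
    using R by (intro exI[of _ y]) force
  ultimately show ?L by simp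
qed

text \<open>
  Here and below \<open>b s\<close> names the part of one fixed oracle known at stage \<open>s\<close>.
\<close>

lemma fuel_run_mono:
  assumes Q: "\<And>s s' x. Q (b s) s x \<noteq> 0 \<Longrightarrow> s \<le> s' \<Longrightarrow> Q (b s') s' x = Q (b s) s x"
    and "fuel_run Q c (b s) s x = Suc y" "s \<le> s'"
  shows "fuel_run Q c (b s') s' x = Suc y"
  using assms(2)
proof (induction c arbitrary: x y)
  case Query
  then show ?case using Q[of s x s'] assms(3) by simp
next
  case (Tup f g)
  obtain u v where "fuel_run Q f (b s) s x = Suc u" "fuel_run Q g (b s) s x = Suc v"
    using Tup.prems by (auto simp: gr0_conv_Suc split: if_splits)
  with Tup show ?case by simp
next
  case (Comp f g)
  obtain u where "fuel_run Q g (b s) s x = Suc u"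
    using Comp.prems by (auto simp: gr0_conv_Suc split: if_splits)
  with Comp show ?case by simp
next
  case (PRec f g)
  have "rec_nat (fuel_run Q f (b s') s' (pfst x))
       (\<lambda>i r. if r = 0 then 0 else fuel_run Q g (b s') s' (prod_encode (pfst x, prod_encode (i, r - 1))))
       m = Suc y"
    if "rec_nat (fuel_run Q f (b s) s (pfst x))
       (\<lambda>i r. if r = 0 then 0 else fuel_run Q g (b s) s (prod_encode (pfst x, prod_encode (i, r - 1))))
       m = Suc y" for m y
    using that
  proof (induction m arbitrary: y)
    case 0
    then show ?case by (auto intro: PRec.IH)
  next
    case (Suc m)
    obtain r where "rec_nat (fuel_run Q f (b s) s (pfst x))
       (\<lambda>i r. if r = 0 then 0 else fuel_run Q g (b s) s (prod_encode (pfst x, prod_encode (i, r - 1))))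
       m = Suc r"
      using Suc.prems by (auto simp: gr0_conv_Suc split: if_splits)
    with Suc show ?case by (auto intro: PRec.IH)
  qed
  then show ?case using PRec.prems by simp
next
  case (Mu f)
  have *: "\<exists>v. fuel_run Q f (b s') s' (prod_encode (x, i)) = Suc (Suc v)" if "i < y" for i
    using Mu.prems that Mu.IH unfolding fuel_run_Mu_eq_Suc_iff
    by (metis One_nat_def less_iff_Suc_add add_Suc)
  from Mu.prems have "fuel_run Q f (b s) s (prod_encode (x, y)) = Suc 0" "y < s"
    unfolding fuel_run_Mu_eq_Suc_iff by auto
  with Mu.IH show ?case
    unfolding fuel_run_Mu_eq_Suc_iff using * assms(3)
    by (metis One_nat_def lessI less_Suc_eq_le less_iff_Suc_add order_less_le_trans not_less_eq
        zero_less_Suc Suc_less_eq)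
qed auto

lemma run_if_fuel_run:
  assumes Q: "\<And>x y. Q b s x = Suc y \<Longrightarrow> h x = y"
    and "fuel_run Q c b s x = Suc y"
  shows "run c h x = Some y"
  using assms(2)
proof (induction c arbitrary: x y)
  case Query
  then show ?case using Q by simp
next
  case (Tup f g)
  obtain u v where "fuel_run Q f b s x = Suc u" "fuel_run Q g b s x = Suc v"
    using Tup.prems by (auto simp: gr0_conv_Suc split: if_splits)
  with Tup show ?case by simp
next
  case (Comp f g)
  obtain u where "fuel_run Q g b s x = Suc u"
    using Comp.prems by (auto simp: gr0_conv_Suc split: if_splits)
  with Comp show ?case by simp
next
  case (PRec f g)
  have "rec_nat (run f h (pfst x))
      (\<lambda>i r. Option.bind r (\<lambda>v. run g h (prod_encode (pfst x, prod_encode (i, v))))) m = Some y"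
    if "rec_nat (fuel_run Q f b s (pfst x))
       (\<lambda>i r. if r = 0 then 0 else fuel_run Q g b s (prod_encode (pfst x, prod_encode (i, r - 1))))
       m = Suc y" for m y
    using that
  proof (induction m arbitrary: y)
    case 0
    then show ?case by (auto intro: PRec.IH)
  next
    case (Suc m)
    obtain r where "rec_nat (fuel_run Q f b s (pfst x))
       (\<lambda>i r. if r = 0 then 0 else fuel_run Q g b s (prod_encode (pfst x, prod_encode (i, r - 1))))
       m = Suc r"
      using Suc.prems by (auto simp: gr0_conv_Suc split: if_splits)
    with Suc show ?case by (auto intro: PRec.IH)
  qed
  then show ?case using PRec.prems by (auto simp: case_prod_unfold)
next
  case (Mu f)
  have "\<exists>v. run f h (prod_encode (x, i)) = Some (Suc v)" if "i < y" for i
    using Mu.prems that Mu.IH unfolding fuel_run_Mu_eq_Suc_iff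
    by (metis One_nat_def less_iff_Suc_add add_Suc)
  with Mu.prems Mu.IH show ?case
    unfolding fuel_run_Mu_eq_Suc_iff run_Mu_eq_Some_iff by simp
qed auto

lemma fuel_run_if_run:
  assumes Q: "\<And>s s' x. Q (b s) s x \<noteq> 0 \<Longrightarrow> s \<le> s' \<Longrightarrow> Q (b s') s' x = Q (b s) s x"
    and answers: "\<And>x. \<exists>s. Q (b s) s x = Suc (h x)"
    and "run c h x = Some y"
  shows "\<exists>s. fuel_run Q c (b s) s x = Suc y"
  using assms(3)
proof (induction c arbitrary: x y)
  case Query
  then have "y = h x" by simp
  then show ?case using answers[of x] by simp
next
  case (Tup f g)
  obtain u v where uv: "run f h x = Some u" "run g h x = Some v" "y = prod_encode (u, v)"
    using Tup.prems by (auto simp: bind_eq_Some_conv)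
  then obtain s t where "fuel_run Q f (b s) s x = Suc u" "fuel_run Q g (b t) t x = Suc v"
    using Tup.IH by meson
  then have "fuel_run Q f (b (max s t)) (max s t) x = Suc u" "fuel_run Q g (b (max s t)) (max s t) x = Suc v"
    using fuel_run_mono[of Q b, OF Q] by (meson max.cobounded1 max.cobounded2)+
  with uv show ?case by (intro exI[of _ "max s t"]) simp
next
  case (Comp f g)
  obtain u where u: "run g h x = Some u" "run f h u = Some y"
    using Comp.prems by (auto simp: bind_eq_Some_conv)
  then obtain s t where "fuel_run Q g (b s) s x = Suc u" "fuel_run Q f (b t) t u = Suc y"
    using Comp.IH by meson
  then have "fuel_run Q g (b (max s t)) (max s t) x = Suc u" "fuel_run Q f (b (max s t)) (max s t) u = Suc y"
    using fuel_run_mono[of Q b, OF Q] by (meson max.cobounded1 max.cobounded2)+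
  then show ?case by (intro exI[of _ "max s t"]) simp
next
  case (PRec f g)
  let ?R = "\<lambda>s. rec_nat (fuel_run Q f (b s) s (pfst x))
       (\<lambda>i r. if r = 0 then 0 else fuel_run Q g (b s) s (prod_encode (pfst x, prod_encode (i, r - 1))))"
  have R: "?R s m = fuel_run Q (PRec f g) (b s) s (prod_encode (pfst x, m))" for s m
    unfolding fuel_run.simps prod_encode_inverse fst_conv snd_conv ..
  have "\<exists>s. ?R s m = Suc y"
    if "rec_nat (run f h (pfst x))
      (\<lambda>i r. Option.bind r (\<lambda>v. run g h (prod_encode (pfst x, prod_encode (i, v))))) m = Some y" for m y
    using that
  proof (induction m arbitrary: y)
    case 0
    then show ?case using PRec.IH by simp
  next
    case (Suc m)
    obtain r where r: "rec_nat (run f h (pfst x))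
      (\<lambda>i r. Option.bind r (\<lambda>v. run g h (prod_encode (pfst x, prod_encode (i, v))))) m = Some r"
      "run g h (prod_encode (pfst x, prod_encode (m, r))) = Some y"
      using Suc.prems by (auto simp: bind_eq_Some_conv)
    then obtain s t where s: "?R s m = Suc r"
      and t: "fuel_run Q g (b t) t (prod_encode (pfst x, prod_encode (m, r))) = Suc y"
      using Suc.IH PRec.IH by meson
    have "?R (max s t) m = Suc r"
      using fuel_run_mono[of Q b, OF Q s[unfolded R], of "max s t"] unfolding R by simp
    moreover have "fuel_run Q g (b (max s t)) (max s t) (prod_encode (pfst x, prod_encode (m, r))) = Suc y"
      using fuel_run_mono[of Q b, OF Q t, of "max s t"] by simp
    ultimately show ?case by (intro exI[of _ "max s t"]) simp
  qed
  then show ?case using PRec.prems by (simp add: case_prod_unfold)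
next
  case (Mu f)
  \<comment> \<open>a single amount of fuel serves all arguments up to the first zero\<close>
  have "\<exists>s. \<forall>i\<le>m. \<exists>v. fuel_run Q f (b s) s (prod_encode (x, i)) = Suc v" if "m \<le> y" for m
    using that
  proof (induction m)
    case 0
    then show ?case using Mu.prems Mu.IH unfolding run_Mu_eq_Some_iff
      by (metis le_zero_eq not_gr_zero)
  next
    case (Suc m)
    then obtain s where s: "\<forall>i\<le>m. \<exists>v. fuel_run Q f (b s) s (prod_encode (x, i)) = Suc v"
      by auto
    have "\<exists>v. run f h (prod_encode (x, Suc m)) = Some v"
      using Mu.prems Suc.prems unfolding run_Mu_eq_Some_iff
      by (metis order_le_imp_less_or_eq)
    then obtain t v where t: "fuel_run Q f (b t) t (prod_encode (x, Suc m)) = Suc v"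
      using Mu.IH by blast
    have "\<exists>v. fuel_run Q f (b (max s t)) (max s t) (prod_encode (x, i)) = Suc v" if "i \<le> Suc m" for i
    proof (cases "i = Suc m")
      case True
      then show ?thesis using fuel_run_mono[of Q b, OF Q t, of "max s t"] by auto
    next
      case False
      then obtain v where "fuel_run Q f (b s) s (prod_encode (x, i)) = Suc v"
        using s \<open>i \<le> Suc m\<close> by (meson le_SucE)
      then show ?thesis using fuel_run_mono[of Q b, OF Q, where s = s and s' = "max s t"] by fastforce
    qed
    then show ?case by blast
  qed
  then obtain s where s: "\<And>i. i \<le> y \<Longrightarrow> \<exists>v. fuel_run Q f (b s) s (prod_encode (x, i)) = Suc v"
    by blast
  \<comment> \<open>the range of the search has to include the zero itself\<close>
  define t where "t = max s (Suc y)"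
  have t: "\<exists>v. fuel_run Q f (b t) t (prod_encode (x, i)) = Suc v" if "i \<le> y" for i
    using s[OF that] fuel_run_mono[of Q b, OF Q, where s = s and s' = t] unfolding t_def by fastforce
  have "Q (b t) t z = Suc w \<Longrightarrow> h z = w" for z w
  proof -
    assume zw: "Q (b t) t z = Suc w"
    obtain u where u: "Q (b u) u z = Suc (h z)" using answers by blast
    show "h z = w"
      using Q[of t z "max t u"] Q[of u z "max t u"] zw u by simp
  qed
  then have sound: "run f h (prod_encode (x, i)) = Some v"
    if "fuel_run Q f (b t) t (prod_encode (x, i)) = Suc v" for i v
    using that by (rule run_if_fuel_run)
  have "fuel_run Q f (b t) t (prod_encode (x, y)) = 1"
    using t[of y] sound[of y] Mu.prems unfolding run_Mu_eq_Some_iff by auto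
  moreover have "1 < fuel_run Q f (b t) t (prod_encode (x, i))" if "i < y" for i
  proof -
    obtain v where v: "fuel_run Q f (b t) t (prod_encode (x, i)) = Suc v"
      using t[of i] \<open>i < y\<close> by auto
    then show ?thesis using sound[OF v] Mu.prems \<open>i < y\<close>
      unfolding run_Mu_eq_Some_iff by fastforce
  qed
  moreover have "y < t" by (simp add: t_def)
  ultimately have "fuel_run Q (Mu f) (b t) t x = Suc y"
    unfolding fuel_run_Mu_eq_Suc_iff by blast
  then show ?case by blast
qed auto

text \<open>The special case of the zero oracle, in which description methods run.\<close>

definition fuel_run0 :: "prog \<Rightarrow> nat \<Rightarrow> nat \<Rightarrow> nat" where
  "fuel_run0 c s x = fuel_run (\<lambda>_ _ _. 1) c 0 s x"

lemma computable_fuel_run0 [computable_intros]: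
  "computable s \<Longrightarrow> computable x \<Longrightarrow> computable (\<lambda>z. fuel_run0 c (s z) (x z))"
  unfolding fuel_run0_def by (intro computable_fuel_run computable_intros)

lemma fuel_run0_mono: "fuel_run0 c s x = Suc y \<Longrightarrow> s \<le> s' \<Longrightarrow> fuel_run0 c s' x = Suc y"
  unfolding fuel_run0_def using fuel_run_mono[of "\<lambda>_ _ _. 1" "\<lambda>_. 0" c s x y s'] by simp

lemma run_iff_fuel_run0: "run c (\<lambda>_. 0) x = Some y \<longleftrightarrow> (\<exists>s. fuel_run0 c s x = Suc y)"
  unfolding fuel_run0_def
  using fuel_run_if_run[of "\<lambda>_ _ _. 1" "\<lambda>_. 0" "\<lambda>_. 0" c x y]
    run_if_fuel_run[of "\<lambda>_ _ _. 1" 0 _ "\<lambda>_. 0" c x y] by auto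

section \<open>Limits of computable stages\<close>

text \<open>
  If \<open>P v s\<close> says that \<open>v\<close> has been confirmed as a lower bound by stage \<open>s\<close>, which is
  then also true of all smaller \<open>v\<close>, this is the largest lower bound confirmed by stage \<open>s\<close>, capped at \<open>s\<close> so that it is computable.
  The cap does not affect the limit.
\<close>

definition stage_count :: "(nat \<Rightarrow> nat \<Rightarrow> bool) \<Rightarrow> nat \<Rightarrow> nat" where
  "stage_count P s = (\<Sum>v<s. of_bool (P (Suc v) s))"

lemma le_stage_count_iff:
  assumes "\<And>v w. v \<le> w \<Longrightarrow> P w s \<Longrightarrow> P v s"
  shows "v \<le> stage_count P s \<longleftrightarrow> v = 0 \<or> v \<le> s \<and> P v s"
proof -
  define A where "A = {w. w < s \<and> P (Suc w) s}"
  have fin: "finite A" and As: "A \<subseteq> {..<s}" by (auto simp: A_def)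
  have count: "stage_count P s = card A"
  proof -
    have "stage_count P s = (\<Sum>w\<in>{..<s}. if P (Suc w) s then 1 else 0)"
      unfolding stage_count_def by (intro sum.cong) auto
    also have "\<dots> = card {w \<in> {..<s}. P (Suc w) s}"
      by (subst sum.inter_filter[symmetric]) auto
    also have "{w \<in> {..<s}. P (Suc w) s} = A" by (auto simp: A_def)
    finally show ?thesis .
  qed
  have "v \<le> card A" if "v \<le> s" "P v s"
  proof -
    have "{..<v} \<subseteq> A" using that assms[of _ v] by (auto simp: A_def)
    from card_mono[OF fin this] show ?thesis by simp
  qed
  moreover have "v \<le> s \<and> P v s" if "v \<le> card A" "v \<noteq> 0"
  proof (rule ccontr)
    assume neg: "\<not> (v \<le> s \<and> P v s)"
    have "card A \<le> s" using card_mono[OF _ As] by simp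
    with neg that have "\<not> P v s" by simp
    then have "A \<subseteq> {..<v - 1}"
      using assms[of v "Suc _"] that(2) by (force simp: A_def)
    from card_mono[OF _ this] that show False by simp
  qed
  ultimately show ?thesis by (auto simp: count)
qed

lemma computable_stage_count:
  assumes "decidable (\<lambda>z. P (pfst z) (pfst (psnd z)) (psnd (psnd z)))" "computable a" "computable s"
  shows "computable (\<lambda>x. stage_count (P (a x)) (s x))"
  unfolding stage_count_def
proof (intro computable_intros assms)
  have "computable (\<lambda>z. of_bool (P (a (pfst z)) (Suc (psnd z)) (s (pfst z))))"
    by (rule computable_comp3[OF assms(1)[unfolded decidable_def]];
        intro computable_intros assms(2,3)[THEN computable_comp])
  then show "decidable (\<lambda>z. P (a (pfst z)) (Suc (psnd z)) (s (pfst z)))"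
    by (simp add: decidable_def)
qed

section \<open>Dyadic paths\<close>

text \<open>
  A path runs through the nested dyadic intervals from \<open>\<beta> s / 2 ^ s\<close> to
  \<open>(\<beta> s + 1) / 2 ^ s\<close>, so \<open>\<beta> s\<close> determines all earlier values.
\<close>

definition dyadic_path :: "(nat \<Rightarrow> nat) \<Rightarrow> bool" where
  "dyadic_path \<beta> \<longleftrightarrow> \<beta> 0 = 0 \<and> (\<forall>s. \<beta> (Suc s) div 2 = \<beta> s)"

lemma dyadic_path_div:
  assumes "dyadic_path \<beta>" "s \<le> t"
  shows "\<beta> t div 2 ^ (t - s) = \<beta> s"
  using assms(2)
proof (induction t rule: dec_induct)
  case (step t)
  then have "\<beta> (Suc t) div 2 ^ (Suc t - s) = \<beta> (Suc t) div 2 div 2 ^ (t - s)"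
    by (simp add: Suc_diff_le div_mult2_eq)
  with step assms(1) show ?case by (simp add: dyadic_path_def)
qed simp

lemma dyadic_path_less:
  assumes "dyadic_path \<beta>"
  shows "\<beta> s < 2 ^ s"
proof (induction s)
  case (Suc s)
  have "\<beta> (Suc s) div 2 = \<beta> s" using assms by (simp add: dyadic_path_def)
  with Suc show ?case by simp
qed (use assms in \<open>simp add: dyadic_path_def\<close>)

lemma ex_dyadic_path_through:
  assumes "b < 2 ^ s"
  shows "\<exists>\<beta>. dyadic_path \<beta> \<and> \<beta> s = b"
proof -
  define \<beta> where "\<beta> t = (if t \<le> s then b div 2 ^ (s - t) else b * 2 ^ (t - s))" for t
  have "\<beta> (Suc t) div 2 = \<beta> t" for t
  proof (cases "Suc t \<le> s")
    case True
    then have "2 ^ (s - t) = 2 ^ (s - Suc t) * (2::nat)"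
      by (metis Suc_diff_Suc Suc_le_lessD power_Suc2)
    with True show ?thesis by (simp add: \<beta>_def div_mult2_eq)
  next
    case False
    then have "\<beta> (Suc t) = \<beta> t * 2"
      by (auto simp: \<beta>_def Suc_diff_le le_Suc_eq not_le)
    then show ?thesis by simp
  qed
  moreover have "\<beta> 0 = 0" "\<beta> s = b" using assms by (auto simp: \<beta>_def)
  ultimately show ?thesis unfolding dyadic_path_def by blast
qed

text \<open>
  Koenig's lemma: a node with bad descendants at every depth has a child with the same property, so a
  path can be followed forever.
\<close>

lemma infinite_binary_tree_has_path:
  assumes parent: "\<And>s b. bad (Suc s) b \<Longrightarrow> bad s (b div 2)"
    and infinite: "\<And>s. \<exists>b<2 ^ s. bad s b"
  shows "\<exists>\<beta>. dyadic_path \<beta> \<and> (\<forall>s. bad s (\<beta> s))"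
proof -
  define deep where "deep s b \<longleftrightarrow> (\<forall>t. \<exists>c. bad (s + t) c \<and> c div 2 ^ t = b)" for s b
  have ancestor: "bad s (c div 2 ^ t)" if "bad (s + t) c" for s t c
    using that
  proof (induction t arbitrary: c)
    case (Suc t)
    then show ?case using Suc.IH[of "c div 2"] parent[of "s + t" c] by (simp add: div_mult2_eq)
  qed simp
  have root: "deep 0 0"
    unfolding deep_def
  proof
    fix t
    obtain b where "b < 2 ^ t" "bad t b" using infinite by blast
    then show "\<exists>c. bad (0 + t) c \<and> c div 2 ^ t = 0" by (intro exI[of _ b]) simp
  qed
  have child: "\<exists>c. deep (Suc s) c \<and> c div 2 = b" if "deep s b" for s b
  proof (rule ccontr)
    assume neg: "\<not> ?thesis"
    have "\<not> deep (Suc s) (2 * b)" "\<not> deep (Suc s) (2 * b + 1)" using neg by auto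
    then obtain t u where
      t: "\<And>c. bad (Suc s + t) c \<Longrightarrow> c div 2 ^ t \<noteq> 2 * b" and
      u: "\<And>c. bad (Suc s + u) c \<Longrightarrow> c div 2 ^ u \<noteq> 2 * b + 1"
      unfolding deep_def by blast
    define w where "w = max t u"
    obtain c where c: "bad (s + Suc w) c" "c div 2 ^ Suc w = b"
      using \<open>deep s b\<close> unfolding deep_def by blast
    have down: "bad (Suc s + i) (c div 2 ^ (w - i)) \<and> c div 2 ^ (w - i) div 2 ^ i = c div 2 ^ w"
      if "i \<le> w" for i
    proof
      have "s + Suc w = (Suc s + i) + (w - i)" using that by simp
      then show "bad (Suc s + i) (c div 2 ^ (w - i))" using ancestor c(1) by metis
      show "c div 2 ^ (w - i) div 2 ^ i = c div 2 ^ w"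
        using that by (simp add: div_mult2_eq[symmetric] power_add[symmetric])
    qed
    have "c div 2 ^ w \<noteq> 2 * b" "c div 2 ^ w \<noteq> 2 * b + 1"
      using down[of t] down[of u] t u by (auto simp: w_def)
    moreover have "c div 2 ^ w div 2 = b"
      using c(2) by (simp add: div_mult2_eq[symmetric] mult.commute)
    moreover have "q = 2 * b \<or> q = 2 * b + 1" if "q div 2 = b" for q :: nat
      using that by presburger
    ultimately show False by blast
  qed
  have "\<exists>\<beta>. \<forall>s. (deep s (\<beta> s) \<and> (s = 0 \<longrightarrow> \<beta> s = 0)) \<and> \<beta> (Suc s) div 2 = \<beta> s"
  proof (rule dependent_nat_choice)
    show "\<exists>b. deep 0 b \<and> ((0::nat) = 0 \<longrightarrow> b = 0)" using root by blast
    fix b s assume "deep s b \<and> (s = 0 \<longrightarrow> b = 0)"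
    then show "\<exists>c. (deep (Suc s) c \<and> (Suc s = 0 \<longrightarrow> c = 0)) \<and> c div 2 = b"
      using child by simp
  qed
  then obtain \<beta> where "\<And>s. deep s (\<beta> s)" "\<And>s. \<beta> (Suc s) div 2 = \<beta> s" "\<beta> 0 = 0"
    by blast
  moreover have "bad s b" if "deep s b" for s b
    using that[unfolded deep_def, rule_format, of 0] by simp
  ultimately show ?thesis unfolding dyadic_path_def by blast
qed

text \<open>
  The midpoints of the intervals of a path. Their numerators are odd, so these fractions are in lowest
  terms, and their codes are computed without any cancellation.
\<close>

definition dyadic_oracle :: "(nat \<Rightarrow> nat) \<Rightarrow> nat \<Rightarrow> rat" where
  "dyadic_oracle \<beta> i = Fract (2 * int (\<beta> i) + 1) (2 ^ Suc i)"

lemma encode_dyadic_oracle: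
  "encode_rat (dyadic_oracle \<beta> i) = prod_encode (2 * (2 * \<beta> i + 1), 2 * 2 ^ Suc i)"
proof -
  have "coprime (2 * int (\<beta> i) + 1) (2 ^ Suc i)"
    by (intro coprime_power_right_iff[THEN iffD2]) simp
  then have "quotient_of (dyadic_oracle \<beta> i) = (2 * int (\<beta> i) + 1, 2 ^ Suc i)"
    unfolding dyadic_oracle_def quotient_of_Fract by (intro normalize_stable) auto
  moreover have "int_encode (int n) = 2 * n" for n
    by (simp add: int_encode_def sum_encode_def)
  from this[of "2 * \<beta> i + 1"] this[of "2 ^ Suc i"]
  have "int_encode (2 * int (\<beta> i) + 1) = 2 * (2 * \<beta> i + 1)" "int_encode (2 ^ Suc i) = 2 * 2 ^ Suc i"
    by (simp_all add: algebra_simps)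
  ultimately show ?thesis unfolding encode_rat_def by simp
qed

lemma approximates_dyadic_oracle:
  assumes "\<And>s. real (\<beta> s) / 2 ^ s \<le> p" "\<And>s. p \<le> (real (\<beta> s) + 1) / 2 ^ s"
  shows "approximates (dyadic_oracle \<beta>) p"
  unfolding approximates_def
proof
  fix i
  have "real_of_rat (dyadic_oracle \<beta> i) = (2 * real (\<beta> i) + 1) / (2 * 2 ^ i)"
    by (simp add: dyadic_oracle_def Fract_of_int_quotient of_rat_divide of_rat_add of_rat_mult of_rat_power)
  moreover have "real (\<beta> i) \<le> p * 2 ^ i" "p * 2 ^ i \<le> real (\<beta> i) + 1"
    using assms[of i] by (simp_all add: field_simps)
  ultimately show "\<bar>real_of_rat (dyadic_oracle \<beta> i) - p\<bar> \<le> 1 / 2 ^ i"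
    by (auto simp: field_simps abs_le_iff)
qed

text \<open>
  The left ends increase and the right ends decrease, hence the supremum of the left ends lies in all
  intervals.
\<close>

lemma dyadic_path_point:
  assumes "dyadic_path \<beta>"
  obtains p where "p \<in> {0..1}" "approximates (dyadic_oracle \<beta>) p"
proof -
  define l where "l s = real (\<beta> s) / 2 ^ s" for s
  have step: "2 * \<beta> s \<le> \<beta> (Suc s)" "\<beta> (Suc s) \<le> 2 * \<beta> s + 1" for s
  proof -
    have "\<beta> (Suc s) div 2 = \<beta> s" using assms by (simp add: dyadic_path_def)
    then show "2 * \<beta> s \<le> \<beta> (Suc s)" "\<beta> (Suc s) \<le> 2 * \<beta> s + 1" by presburger+
  qed
  have l_le: "l s \<le> l (s + t)" for s t
  proof (induction t)
    case (Suc t)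
    have "l (s + t) \<le> l (s + Suc t)"
      using step(1)[of "s + t"] by (simp add: l_def field_simps flip: of_nat_mult of_nat_power)
    with Suc show ?case by simp
  qed simp
  have l_ge: "l (s + t) + 1 / 2 ^ (s + t) \<le> l s + 1 / 2 ^ s" for s t
  proof (induction t)
    case (Suc t)
    have "real (\<beta> (Suc (s + t))) \<le> 2 * real (\<beta> (s + t)) + 1"
      using step(2)[of "s + t"] by linarith
    then have "(real (\<beta> (Suc (s + t))) + 1) / 2 ^ Suc (s + t)
        \<le> (2 * real (\<beta> (s + t)) + 2) / 2 ^ Suc (s + t)"
      by (intro divide_right_mono) auto
    then have "l (s + Suc t) + 1 / 2 ^ (s + Suc t) \<le> l (s + t) + 1 / 2 ^ (s + t)"
      by (simp add: l_def add_divide_distrib)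
    with Suc show ?case by simp
  qed simp
  have bound: "l t \<le> l s + 1 / 2 ^ s" for s t
  proof -
    have "l t \<le> l (s + t)" using l_le[of t s] by (simp add: add.commute)
    also have "\<dots> \<le> l (s + t) + 1 / 2 ^ (s + t)" by simp
    also have "\<dots> \<le> l s + 1 / 2 ^ s" by (rule l_ge)
    finally show ?thesis .
  qed
  define p where "p = (SUP s. l s)"
  have bdd: "bdd_above (range l)" using bound[of _ 0] by (intro bdd_aboveI2[of _ _ "l 0 + 1"]) simp
  have lower: "l s \<le> p" for s
    unfolding p_def by (intro cSUP_upper bdd) auto
  moreover have upper: "p \<le> l s + 1 / 2 ^ s" for s
    unfolding p_def using bound by (intro cSUP_least) auto
  ultimately have "approximates (dyadic_oracle \<beta>) p"
    by (intro approximates_dyadic_oracle) (auto simp: l_def add_divide_distrib)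
  moreover have "p \<in> {0..1}"
    using lower[of 0] upper[of 0] assms by (auto simp: l_def dyadic_path_def)
  ultimately show ?thesis using that by blast
qed

text \<open>
  The path of \<open>p\<close> consists of the integer parts of \<open>2 ^ s * p\<close>. This fails for
  \<open>p = 1\<close>, which has to be reached as the right end of its intervals.
\<close>

lemma ex_dyadic_path_approximating:
  assumes "p \<in> {0..1}"
  shows "\<exists>\<beta>. dyadic_path \<beta> \<and> approximates (dyadic_oracle \<beta>) p"
proof (cases "p = 1")
  case True
  define \<beta> :: "nat \<Rightarrow> nat" where "\<beta> s = 2 ^ s - 1" for s
  have "(2 * 2 ^ s - 1) div 2 = (2 ^ s - 1 :: nat)" for s
    by (cases "2 ^ s :: nat") auto
  then have "dyadic_path \<beta>" by (simp add: dyadic_path_def \<beta>_def)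
  moreover have "approximates (dyadic_oracle \<beta>) p"
    by (intro approximates_dyadic_oracle) (auto simp: True \<beta>_def of_nat_diff)
  ultimately show ?thesis by blast
next
  case False
  define \<beta> where "\<beta> s = nat \<lfloor>2 ^ s * p\<rfloor>" for s
  have "\<lfloor>2 ^ Suc s * p\<rfloor> div 2 = \<lfloor>2 ^ s * p\<rfloor>" for s
    using floor_divide_real_eq_div[of 2 "2 ^ Suc s * p"] by simp
  then have "\<beta> (Suc s) div 2 = \<beta> s" for s
    using nat_div_distrib'[of 2 "\<lfloor>2 ^ Suc s * p\<rfloor>"] unfolding \<beta>_def by simp
  moreover have "\<beta> 0 = 0" using assms False by (auto simp: \<beta>_def floor_eq_iff)
  ultimately have "dyadic_path \<beta>" by (simp add: dyadic_path_def)
  moreover have "approximates (dyadic_oracle \<beta>) p"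
  proof (rule approximates_dyadic_oracle)
    fix s
    have "real (\<beta> s) = of_int \<lfloor>2 ^ s * p\<rfloor>"
      using assms by (auto simp: \<beta>_def)
    moreover have "of_int \<lfloor>2 ^ s * p\<rfloor> \<le> 2 ^ s * p" "2 ^ s * p \<le> of_int \<lfloor>2 ^ s * p\<rfloor> + 1"
      by linarith+
    ultimately show "real (\<beta> s) / 2 ^ s \<le> p" "p \<le> (real (\<beta> s) + 1) / 2 ^ s"
      by (simp_all add: field_simps)
  qed
  ultimately show ?thesis by blast
qed

section \<open>The infimum of a test over the parameter\<close>

text \<open>
  The answers that the oracle of a path through \<open>b\<close> at level \<open>s\<close> gives to queries up to
  \<open>s\<close>; see \<open>dyadic_answer_path\<close>.
\<close>

definition dyadic_answer :: "nat \<Rightarrow> nat \<Rightarrow> nat \<Rightarrow> nat" where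
  "dyadic_answer b s i =
     (if i \<le> s then Suc (prod_encode (2 * (2 * (b div 2 ^ (s - i)) + 1), 2 * 2 ^ Suc i)) else 0)"

lemma computable_dyadic_answer:
  "computable (\<lambda>z. dyadic_answer (pfst z) (pfst (psnd z)) (psnd (psnd z)))"
  unfolding dyadic_answer_def by (intro computable_intros)

lemma dyadic_answer_path:
  assumes "dyadic_path \<beta>"
  shows "dyadic_answer (\<beta> s) s i = (if i \<le> s then Suc (encode_rat (dyadic_oracle \<beta> i)) else 0)"
  using dyadic_path_div[OF assms] by (simp add: dyadic_answer_def encode_dyadic_oracle)

abbreviation partial_run :: "prog \<Rightarrow> nat \<Rightarrow> nat \<Rightarrow> nat \<Rightarrow> nat" where
  "partial_run \<equiv> fuel_run dyadic_answer"

lemma partial_run_mono: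
  assumes "dyadic_path \<beta>" "partial_run c (\<beta> s) s x = Suc y" "s \<le> t"
  shows "partial_run c (\<beta> t) t x = Suc y"
  using assms by (intro fuel_run_mono[of dyadic_answer \<beta>, OF _ assms(2,3)])
    (auto simp: dyadic_answer_path split: if_splits)

lemma run_dyadic_oracle_iff:
  assumes "dyadic_path \<beta>"
  shows "run c (\<lambda>i. encode_rat (dyadic_oracle \<beta> i)) x = Some y
    \<longleftrightarrow> (\<exists>s. partial_run c (\<beta> s) s x = Suc y)"
proof
  assume "run c (\<lambda>i. encode_rat (dyadic_oracle \<beta> i)) x = Some y"
  then show "\<exists>s. partial_run c (\<beta> s) s x = Suc y"
    by (rule fuel_run_if_run[rotated -1])
       (auto simp: dyadic_answer_path[OF assms] split: if_splits)
next
  assume "\<exists>s. partial_run c (\<beta> s) s x = Suc y"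
  then obtain s where "partial_run c (\<beta> s) s x = Suc y" ..
  then show "run c (\<lambda>i. encode_rat (dyadic_oracle \<beta> i)) x = Some y"
    by (rule run_if_fuel_run[rotated])
       (auto simp: dyadic_answer_path[OF assms] split: if_splits)
qed

text \<open>
  The shift by a lower bound \<open>- c\<close> turns integer values of tests into natural numbers.
\<close>

definition shifted_value :: "nat \<Rightarrow> nat \<Rightarrow> nat" where
  "shifted_value c y = (if odd y then c - Suc (y div 2) else c + y div 2)"

lemma shifted_value_int_encode: "shifted_value c (int_encode z) = nat (z + int c)"
  by (cases "0 \<le> z") (auto simp: shifted_value_def int_encode_def sum_encode_def nat_add_distrib)

text \<open>
  The test program \<open>c\<close> for the size and outcome coded by \<open>nx\<close> has, within fuel \<open>s\<close> and
  knowing only that the path passes through \<open>b\<close>, printed an integer which after the shift by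
  \<open>C\<close> is at least \<open>v\<close>.
\<close>

definition verified :: "prog \<Rightarrow> nat \<Rightarrow> nat \<Rightarrow> nat \<Rightarrow> nat \<Rightarrow> nat \<Rightarrow> bool" where
  "verified c C nx v b s \<longleftrightarrow>
     (\<exists>j<Suc s. 0 < partial_run c b s (prod_encode (pfst nx, prod_encode (psnd nx, j))) \<and>
        v \<le> shifted_value C (partial_run c b s (prod_encode (pfst nx, prod_encode (psnd nx, j))) - 1))"

lemma verified_Suc:
  assumes "b < 2 ^ Suc s" "verified c C nx v (b div 2) s"
  shows "verified c C nx v b (Suc s)"
proof -
  obtain \<beta> where \<beta>: "dyadic_path \<beta>" "\<beta> (Suc s) = b"
    using ex_dyadic_path_through[OF assms(1)] by blast
  then have "\<beta> s = b div 2" by (auto simp: dyadic_path_def)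
  with assms(2) obtain j y where j: "j < Suc s" "v \<le> shifted_value C y"
    and y: "partial_run c (\<beta> s) s (prod_encode (pfst nx, prod_encode (psnd nx, j))) = Suc y"
    unfolding verified_def by (auto simp: gr0_conv_Suc)
  have "partial_run c b (Suc s) (prod_encode (pfst nx, prod_encode (psnd nx, j))) = Suc y"
    using partial_run_mono[OF \<beta>(1) y, of "Suc s"] \<beta>(2) by simp
  with j show ?thesis unfolding verified_def by (intro exI[of _ j]) simp
qed

text \<open>
  The bound \<open>v\<close> holds for all \<open>p\<close> exactly if at some level of the tree it is verified at every
  node. One direction is clear, since each \<open>p\<close> has a path. For the other, if each level had a node
  without verification, these nodes would form an infinite tree; a path in it belongs to a
  \<open>p\<close> for which the bound is never printed, although the program is correct for the oracle of
  that path. Correctness for all oracles, and not just for computable ones, enters here.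
\<close>

theorem inf_over_parameter_enumerable:
  fixes e :: "'a \<Rightarrow> nat" and C :: nat
  assumes "lower_semicomputable S e T"
    and lower: "\<And>n p x. 0 < n \<Longrightarrow> p \<in> {0..1} \<Longrightarrow> x \<in> S n \<Longrightarrow> - ereal C \<le> T n p x"
  obtains G where "computable (\<lambda>z. G (pfst z) (pfst (psnd z)) (psnd (psnd z)))"
    and "\<And>n k. mono (G n k)"
    and "\<And>n x v. 0 < n \<Longrightarrow> x \<in> S n \<Longrightarrow>
      (\<exists>s. v \<le> G n (e x) s) \<longleftrightarrow> (\<forall>p\<in>{0..1}. ereal (real v) - ereal C \<le> T n p x)"
proof -
  obtain c where c: "\<And>n p x a. 0 < n \<Longrightarrow> p \<in> {0..1} \<Longrightarrow> x \<in> S n \<Longrightarrow> approximates a p \<Longrightarrow>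
    \<exists>m :: nat \<Rightarrow> int. mono m \<and>
      (\<forall>j. run c (\<lambda>i. encode_rat (a i)) (prod_encode (n, prod_encode (e x, j))) = Some (int_encode (m j))) \<and>
      (SUP j. ereal (of_int (m j))) = T n p x"
    using assms(1) unfolding lower_semicomputable_def by meson
  define R where "R nx v s \<longleftrightarrow> (\<forall>b<2 ^ s. verified c C nx v b s)" for nx v s
  define G where "G n k s = stage_count (R (prod_encode (n, k))) s" for n k s
  have R_antimono: "R nx v s" if "v \<le> w" "R nx w s" for nx v w s
    using that unfolding R_def verified_def by (meson order_trans)
  have R_Suc: "R nx v (Suc s)" if "R nx v s" for nx v s
    unfolding R_def
  proof (intro allI impI verified_Suc)
    fix b :: nat assume "b < 2 ^ Suc s"
    then have "b div 2 < 2 ^ s" by auto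
    with that show "verified c C nx v (b div 2) s" unfolding R_def by blast
  qed
  have R_mono: "R nx v t" if "R nx v s" "s \<le> t" for nx v s t
    using that(2,1) by (induction t rule: dec_induct) (auto intro: R_Suc)
  have G_iff: "v \<le> G n k s \<longleftrightarrow> v = 0 \<or> v \<le> s \<and> R (prod_encode (n, k)) v s" for v n k s
    unfolding G_def by (intro le_stage_count_iff) (rule R_antimono)
  have "decidable (\<lambda>z. R (pfst z) (pfst (psnd z)) (psnd (psnd z)))"
    unfolding R_def verified_def shifted_value_def
    by (intro computable_intros computable_fuel_run computable_dyadic_answer)
  then have "computable (\<lambda>z. G (pfst z) (pfst (psnd z)) (psnd (psnd z)))"
    unfolding G_def by (intro computable_stage_count computable_intros)
  moreover have "mono (G n k)" for n k
  proof (rule monoI)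
    fix s t :: nat assume "s \<le> t"
    have "G n k s \<le> G n k s" ..
    then show "G n k s \<le> G n k t"
      using \<open>s \<le> t\<close> unfolding G_iff by (meson R_mono order_trans)
  qed
  moreover have "(\<exists>s. v \<le> G n (e x) s) \<longleftrightarrow> (\<forall>p\<in>{0..1}. ereal (real v) - ereal C \<le> T n p x)"
    if n: "0 < n" and x: "x \<in> S n" for n x v
  proof (cases "v = 0")
    case True
    then show ?thesis using lower[OF n _ x] by (simp add: G_iff)
  next
    case False
    let ?nx = "prod_encode (n, e x)"
    have "(\<exists>s. v \<le> G n (e x) s) \<longleftrightarrow> (\<exists>s. R ?nx v s)"
    proof
      assume "\<exists>s. R ?nx v s"
      then obtain s where "R ?nx v s" ..
      then have "R ?nx v (max s v)" by (rule R_mono) simp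
      then show "\<exists>s. v \<le> G n (e x) s" unfolding G_iff by (intro exI[of _ "max s v"]) simp
    next
      assume "\<exists>s. v \<le> G n (e x) s"
      then obtain s where "v \<le> G n (e x) s" ..
      then show "\<exists>s. R ?nx v s" using False unfolding G_iff by auto
    qed
    also have "\<dots> \<longleftrightarrow> (\<forall>p\<in>{0..1}. ereal (real v) - ereal C \<le> T n p x)"
    proof
      assume "\<exists>s. R ?nx v s"
      then obtain s where s: "R ?nx v s" ..
      show "\<forall>p\<in>{0..1}. ereal (real v) - ereal C \<le> T n p x"
      proof
        fix p :: real assume p: "p \<in> {0..1}"
        obtain \<beta> where \<beta>: "dyadic_path \<beta>" "approximates (dyadic_oracle \<beta>) p"
          using ex_dyadic_path_approximating[OF p] by blast
        obtain m where m: "\<And>j. run c (\<lambda>i. encode_rat (dyadic_oracle \<beta> i))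
              (prod_encode (n, prod_encode (e x, j))) = Some (int_encode (m j))"
            "(SUP j. ereal (of_int (m j))) = T n p x"
          using c[OF n p x \<beta>(2)] by blast
        have "verified c C ?nx v (\<beta> s) s"
          using s dyadic_path_less[OF \<beta>(1)] unfolding R_def by blast
        then obtain j r where
          r: "partial_run c (\<beta> s) s (prod_encode (n, prod_encode (e x, j))) = Suc r"
          and v: "v \<le> shifted_value C r"
          unfolding verified_def by (auto simp: gr0_conv_Suc)
        have "r = int_encode (m j)"
          using run_dyadic_oracle_iff[OF \<beta>(1)] r m(1)[of j] by (metis option.inject)
        with v False have "int v - int C \<le> m j"
          by (simp add: shifted_value_int_encode)
        then have "real v - real C \<le> of_int (m j)" by linarith
        then have "ereal (real v) - ereal C \<le> ereal (of_int (m j))" by simp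
        also have "\<dots> \<le> T n p x" unfolding m(2)[symmetric] by (intro SUP_upper) auto
        finally show "ereal (real v) - ereal C \<le> T n p x" .
      qed
    next
      assume T: "\<forall>p\<in>{0..1}. ereal (real v) - ereal C \<le> T n p x"
      show "\<exists>s. R ?nx v s"
      proof (rule ccontr)
        assume "\<not> ?thesis"
        then have "\<exists>b<2 ^ s. b < 2 ^ s \<and> \<not> verified c C ?nx v b s" for s
          unfolding R_def by blast
        moreover have "b div 2 < 2 ^ s \<and> \<not> verified c C ?nx v (b div 2) s"
          if "b < 2 ^ Suc s \<and> \<not> verified c C ?nx v b (Suc s)" for s b
          using that verified_Suc by auto
        ultimately obtain \<beta> where \<beta>: "dyadic_path \<beta>" "\<And>s. \<not> verified c C ?nx v (\<beta> s) s"
          using infinite_binary_tree_has_path[of "\<lambda>s b. b < 2 ^ s \<and> \<not> verified c C ?nx v b s"]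
          by blast
        obtain p where p: "p \<in> {0..1}" "approximates (dyadic_oracle \<beta>) p"
          using dyadic_path_point[OF \<beta>(1)] by blast
        obtain m where m: "\<And>j. run c (\<lambda>i. encode_rat (dyadic_oracle \<beta> i))
              (prod_encode (n, prod_encode (e x, j))) = Some (int_encode (m j))"
            "(SUP j. ereal (of_int (m j))) = T n p x"
          using c[OF n p(1) x p(2)] by blast
        \<comment> \<open>the values are integers, so the supremum is attained as soon as it is finite\<close>
        have "\<exists>j. int v - int C \<le> m j"
        proof (rule ccontr)
          assume less: "\<not> (\<exists>j. int v - int C \<le> m j)"
          have "real_of_int (m j) \<le> real v - real C - 1" for j
          proof -
            have "m j \<le> int v - int C - 1" using less by (auto simp: not_le)
            then show ?thesis by linarith
          qed
          then have "T n p x \<le> ereal (real v - real C - 1)"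
            unfolding m(2)[symmetric] by (intro SUP_least) simp
          moreover have "ereal (real v - real C) \<le> T n p x" using T p(1) by simp
          ultimately have "ereal (real v - real C) \<le> ereal (real v - real C - 1)" by (rule order_trans[rotated])
          then show False by simp
        qed
        then obtain j where j: "int v - int C \<le> m j" ..
        obtain s where s: "partial_run c (\<beta> s) s (prod_encode (n, prod_encode (e x, j))) = Suc (int_encode (m j))"
          using m(1)[of j] run_dyadic_oracle_iff[OF \<beta>(1)] by blast
        define t where "t = max s j"
        have "partial_run c (\<beta> t) t (prod_encode (n, prod_encode (e x, j))) = Suc (int_encode (m j))"
          using partial_run_mono[OF \<beta>(1) s] by (simp add: t_def)
        moreover have "j < Suc t" by (simp add: t_def)
        moreover have "v \<le> shifted_value C (int_encode (m j))"
          using j by (simp add: shifted_value_int_encode)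
        ultimately have "verified c C ?nx v (\<beta> t) t"
          unfolding verified_def by (intro exI[of _ j]) simp
        with \<beta>(2) show False by blast
      qed
    qed
    finally show ?thesis .
  qed
  ultimately show ?thesis using that by blast
qed

section \<open>Binary words\<close>

text \<open>
  \<open>word m i\<close> consists of the last \<open>m\<close> binary digits of \<open>i\<close>, the most significant one
  first. Then words with a common prefix form an interval of numbers.
\<close>

primrec word :: "nat \<Rightarrow> nat \<Rightarrow> bool list" where
  "word 0 i = []"
| "word (Suc m) i = odd (i div 2 ^ m) # word m i"

lemma length_word [simp]: "length (word m i) = m"
  by (induction m) auto

lemma word_add_mult: "word m (i + c * 2 ^ m) = word m i"
proof (induction m arbitrary: c)
  case (Suc m)
  have eq: "i + c * 2 ^ Suc m = i + (2 * c) * 2 ^ m" by simp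
  have "(i + (2 * c) * 2 ^ m) div 2 ^ m = 2 * c + i div 2 ^ m"
    by (subst div_mult_self1) auto
  then show ?case using Suc[of "2 * c"] unfolding eq by simp
qed simp

lemma ex_word:
  assumes "length q = m"
  shows "\<exists>i<2 ^ m. word m i = q"
  using assms
proof (induction m arbitrary: q)
  case (Suc m)
  then obtain a r where q: "q = a # r" "length r = m" by (cases q) auto
  obtain i where i: "i < 2 ^ m" "word m i = r" using Suc.IH[OF q(2)] by blast
  have "word (Suc m) (i + of_bool a * 2 ^ m) = q"
    using i q word_add_mult[of m i "of_bool a"] by (cases a) auto
  moreover have "i + of_bool a * 2 ^ m < 2 ^ Suc m" using i by (cases a) auto
  ultimately show ?case by blast
qed simp

lemma word_bij: "bij_betw (word m) {..<2 ^ m} {q. length q = m}"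
proof -
  have image: "word m ` {..<2 ^ m} = {q. length q = m}" using ex_word by force
  have "card {q :: bool list. length q = m} = 2 ^ m"
    using card_lists_length_eq[of "UNIV :: bool set" m] by (simp add: card_UNIV_bool)
  then have "inj_on (word m) {..<2 ^ m}"
    by (intro eq_card_imp_inj_on) (auto simp: image)
  with image show ?thesis unfolding bij_betw_def by blast
qed

lemma word_inject: "word m i = word m j \<Longrightarrow> i < 2 ^ m \<Longrightarrow> j < 2 ^ m \<Longrightarrow> i = j"
  using word_bij[of m] unfolding bij_betw_def by (auto dest: inj_onD)

lemma take_word: "take l (word (l + d) i) = word l (i div 2 ^ d)"
proof (induction l)
  case (Suc l)
  have "i div 2 ^ (l + d) = i div 2 ^ d div 2 ^ l"
    by (simp add: div_mult2_eq[symmetric] power_add mult.commute)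
  with Suc show ?case by simp
qed simp

lemma finite_words_of_length [simp]: "finite {q :: bool list. length q = m}"
  using finite_lists_length_eq[of "UNIV :: bool set" m] by simp

text \<open>
  The form of \<open>encode_word (word m i)\<close> that shows its computability.
\<close>

definition word_code :: "nat \<Rightarrow> nat \<Rightarrow> nat" where
  "word_code m i = rec_nat 0 (\<lambda>j r. Suc (prod_encode (of_bool (odd (i div 2 ^ j)), r))) m"

lemma word_code_eq: "word_code m i = encode_word (word m i)"
  by (induction m) (auto simp: word_code_def encode_word_def)

lemma computable_word_code [computable_intros]:
  assumes "computable m" "computable i"
  shows "computable (\<lambda>x. word_code (m x) (i x))"
  unfolding word_code_def by (intro computable_intros assms assms[THEN computable_comp])

lemma encode_word_inject [simp]: "encode_word q = encode_word r \<longleftrightarrow> q = r"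
proof -
  have "inj (of_bool :: bool \<Rightarrow> nat)" by (auto simp: inj_def of_bool_def split: if_splits)
  then show ?thesis unfolding encode_word_def by (metis inj_eq inj_list_encode inj_mapI)
qed

definition words :: "nat \<Rightarrow> nat \<Rightarrow> bool list set" where
  "words n k = {x. length x = n \<and> count_list x True = k}"

lemma finite_words [simp]: "finite (words n k)"
  unfolding words_def by (rule finite_subset[OF _ finite_words_of_length[of n]]) auto

lemma card_words: "card (words n k) = n choose k"
proof (induction n arbitrary: k)
  case 0
  have "words 0 k = (if k = 0 then {[]} else {})" by (auto simp: words_def)
  then show ?case by simp
next
  case (Suc n)
  have split: "words (Suc n) k = Cons False ` words n k \<union>
      (if k = 0 then {} else Cons True ` words n (k - 1))" for k
  proof (intro set_eqI iffI)
    fix x assume "x \<in> words (Suc n) k"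
    then show "x \<in> Cons False ` words n k \<union> (if k = 0 then {} else Cons True ` words n (k - 1))"
      by (cases x) (auto simp: words_def split: if_splits)
  qed (auto simp: words_def split: if_splits)
  have "card (Cons a ` words n k) = n choose k" for a k
    by (subst card_image) (auto simp: Suc.IH)
  then have "card (words (Suc n) k) = (n choose k) + (if k = 0 then 0 else n choose (k - 1))"
    unfolding split by (subst card_Un_disjoint) auto
  then show ?case by (cases k) auto
qed

definition ones :: "nat \<Rightarrow> nat \<Rightarrow> nat" where
  "ones m i = (\<Sum>j<m. of_bool (odd (i div 2 ^ j)))"

lemma ones_eq: "ones m i = count_list (word m i) True"
  by (induction m) (auto simp: ones_def)

lemma computable_ones [computable_intros]:
  assumes "computable m" "computable i"
  shows "computable (\<lambda>x. ones (m x) (i x))"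
  unfolding ones_def by (intro computable_intros assms assms[THEN computable_comp])

lemma sum_words:
  "(\<Sum>x\<in>words n k. f x) = (\<Sum>i<2 ^ n. if ones n i = k then f (word n i) else 0)"
proof -
  have "(\<Sum>x\<in>words n k. f x) = (\<Sum>x\<in>{q. length q = n}. if count_list x True = k then f x else 0)"
    unfolding words_def by (subst sum.inter_filter[symmetric]) auto
  also have "\<dots> = (\<Sum>i<2 ^ n. if ones n i = k then f (word n i) else 0)"
    unfolding ones_eq by (rule sum.reindex_bij_betw[OF word_bij, symmetric])
  finally show ?thesis .
qed

lemma computable_binomial [computable_intros]:
  assumes "computable n" "computable k"
  shows "computable (\<lambda>x. n x choose k x)"
proof -
  have "(n choose k) = (\<Sum>i<2 ^ n. if ones n i = k then 1 else 0)" for n k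
    by (subst sum_words[symmetric]) (simp add: card_words)
  moreover have "computable (\<lambda>x. \<Sum>i<2 ^ n x. if ones (n x) i = k x then 1 else 0)"
    by (intro computable_intros assms assms[THEN computable_comp])
  ultimately show ?thesis by simp
qed

text \<open>
  A bounded count, so that computability is immediate.
\<close>

definition floor_log2 :: "nat \<Rightarrow> nat" where
  "floor_log2 m = stage_count (\<lambda>v s. 2 ^ v \<le> s) m"

lemma computable_floor_log2 [computable_intros]:
  "computable f \<Longrightarrow> computable (\<lambda>x. floor_log2 (f x))"
  unfolding floor_log2_def
  by (rule computable_stage_count[of "\<lambda>_ v s. 2 ^ v \<le> s"]) (intro computable_intros | assumption)+

lemma floor_log2_bounds:
  assumes "0 < m"
  shows "2 ^ floor_log2 m \<le> m" "m < 2 ^ Suc (floor_log2 m)"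
proof -
  have iff: "v \<le> floor_log2 m \<longleftrightarrow> v = 0 \<or> 2 ^ v \<le> m" for v
  proof -
    have "(2::nat) ^ v \<le> 2 ^ w" if "v \<le> w" for v w :: nat using that by simp
    then have "v \<le> floor_log2 m \<longleftrightarrow> v = 0 \<or> v \<le> m \<and> 2 ^ v \<le> m"
      unfolding floor_log2_def by (intro le_stage_count_iff) (meson order_trans)
    moreover have "v < 2 ^ v" by (rule less_exp)
    ultimately show ?thesis by linarith
  qed
  show "2 ^ floor_log2 m \<le> m" using iff[of "floor_log2 m"] assms by (cases "floor_log2 m") auto
  show "m < 2 ^ Suc (floor_log2 m)" using iff[of "Suc (floor_log2 m)"] by simp
qed

section \<open>Kraft's inequality\<close>

text \<open>
  The sets of extensions of the words to a common length are disjoint.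
\<close>

lemma kraft_inequality:
  fixes Q :: "bool list set"
  assumes fin: "finite Q" and free: "\<And>q r. q \<in> Q \<Longrightarrow> r \<in> Q \<Longrightarrow> prefix q r \<Longrightarrow> q = r"
  shows "(\<Sum>q\<in>Q. 1 / 2 ^ length q :: real) \<le> 1"
proof -
  define N where "N = Max (insert 0 (length ` Q))"
  have le: "length q \<le> N" if "q \<in> Q" for q
    unfolding N_def using fin that by (intro Max_ge) auto
  define ext where "ext q = (@) q ` {r :: bool list. length r = N - length q}" for q
  have card_len: "card {q :: bool list. length q = m} = 2 ^ m" for m
    using bij_betw_same_card[OF word_bij[of m]] by simp
  have card_ext: "card (ext q) = 2 ^ (N - length q)" for q
    unfolding ext_def by (subst card_image) (auto simp: card_len inj_on_def)
  have disj: "ext q \<inter> ext r = {}" if "q \<in> Q" "r \<in> Q" "q \<noteq> r" for q r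
  proof (rule ccontr)
    assume "ext q \<inter> ext r \<noteq> {}"
    then obtain z where "z \<in> ext q" "z \<in> ext r" by blast
    then have "prefix q z" "prefix r z" unfolding ext_def prefix_def by blast+
    then have "prefix q r \<or> prefix r q" by (rule prefix_same_cases)
    with that free show False by blast
  qed
  have "(\<Sum>q\<in>Q. card (ext q)) = card (\<Union>q\<in>Q. ext q)"
    using fin disj by (intro card_UN_disjoint[symmetric]) (auto simp: ext_def)
  also have "\<dots> \<le> card {q :: bool list. length q = N}"
    using le by (intro card_mono) (auto simp: ext_def)
  finally have "(\<Sum>q\<in>Q. 2 ^ (N - length q)) \<le> (2::nat) ^ N" by (simp add: card_ext card_len)
  then have "real (\<Sum>q\<in>Q. 2 ^ (N - length q)) \<le> real (2 ^ N)"
    by (subst of_nat_le_iff)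
  then have "(\<Sum>q\<in>Q. 2 ^ (N - length q) :: real) \<le> 2 ^ N" by simp
  also have "(\<Sum>q\<in>Q. 2 ^ (N - length q) :: real) = (\<Sum>q\<in>Q. 1 / 2 ^ length q) * 2 ^ N"
    unfolding sum_distrib_right using le by (intro sum.cong) (auto simp: power_diff)
  finally show ?thesis by simp
qed

lemma complexity_le: "A q y = Some x \<Longrightarrow> complexity A x y \<le> enat (length q)"
  unfolding complexity_def by (rule INF_lower) simp

lemma complexity_attained:
  assumes "complexity A x y = enat m"
  shows "\<exists>q. A q y = Some x \<and> length q = m"
proof -
  let ?L = "(\<lambda>q. enat (length q)) ` {q. A q y = Some x}"
  have "?L \<noteq> {}"
  proof
    assume "?L = {}"
    then have "complexity A x y = \<infinity>" unfolding complexity_def by (simp add: top_enat_def)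
    with assms show False by simp
  qed
  then obtain l where "l \<in> ?L" by blast
  then have "Inf ?L \<in> ?L" by (rule wellorder_InfI)
  then show ?thesis using assms by (auto simp: complexity_def)
qed

definition complexity_weight :: "method_fun \<Rightarrow> obj \<Rightarrow> obj \<Rightarrow> real" where
  "complexity_weight A x y = (case complexity A x y of enat m \<Rightarrow> 1 / 2 ^ m | \<infinity> \<Rightarrow> 0)"

lemma complexity_weight_nonneg: "0 \<le> complexity_weight A x y"
  by (simp add: complexity_weight_def split: enat.split)

text \<open>
  In a prefix method shortest programs of different objects are never prefixes of each other.
\<close>

lemma sum_complexity_weight_le_1:
  assumes "prefix_method A" "finite X"
  shows "(\<Sum>x\<in>X. complexity_weight A x y) \<le> 1"
proof -
  define Y where "Y = {x \<in> X. complexity A x y \<noteq> \<infinity>}"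
  have "\<forall>x\<in>Y. \<exists>q. A q y = Some x \<and> enat (length q) = complexity A x y"
    using complexity_attained unfolding Y_def by fastforce
  then obtain d where d: "\<And>x. x \<in> Y \<Longrightarrow> A (d x) y = Some x"
    "\<And>x. x \<in> Y \<Longrightarrow> complexity A x y = enat (length (d x))"
    by metis
  have inj: "inj_on d Y" using d(1) by (intro inj_onI) (metis option.inject)
  have "(\<Sum>x\<in>X. complexity_weight A x y) = (\<Sum>x\<in>Y. complexity_weight A x y)"
    unfolding Y_def using assms(2)
    by (intro sum.mono_neutral_right) (auto simp: complexity_weight_def)
  also have "\<dots> = (\<Sum>x\<in>Y. 1 / 2 ^ length (d x))"
    by (intro sum.cong) (auto simp: complexity_weight_def d(2))
  also have "\<dots> = (\<Sum>q\<in>d ` Y. 1 / 2 ^ length q)"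
    by (subst sum.reindex[OF inj]) simp
  also have "\<dots> \<le> 1"
  proof (rule kraft_inequality)
    show "finite (d ` Y)" using assms(2) by (simp add: Y_def)
    fix q r assume "q \<in> d ` Y" "r \<in> d ` Y" "prefix q r"
    then obtain x x' where x: "x \<in> Y" "q = d x" "x' \<in> Y" "r = d x'" by blast
    then have "A r y = Some x"
      using assms(1) \<open>prefix q r\<close> d(1) unfolding prefix_method_def by blast
    with x d(1) show "q = r" by simp
  qed
  finally show ?thesis .
qed

section \<open>Means under Bernoulli and binomial measures\<close>

lemma pmf_bernoulli_measure_eq_binomial:
  assumes "p \<in> {0..1}" "x \<in> words n k"
  shows "pmf (bernoulli_measure n p) x = pmf (binomial_pmf n p) k / real (n choose k)"
proof -
  have x: "length x = n" "count_list x True = k" using assms(2) by (auto simp: words_def)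
  then have "k \<le> n" using count_le_length by metis
  then show ?thesis
    using assms(1) pmf_bernoulli_measure[OF assms(1) x(1)] x(2) by simp
qed

lemma nn_integral_binomial:
  assumes "p \<in> {0..1}" "\<And>k. 0 \<le> f k"
  shows "(\<integral>\<^sup>+k. ennreal (f k) \<partial>measure_pmf (binomial_pmf n p))
    = ennreal (\<Sum>k\<le>n. pmf (binomial_pmf n p) k * f k)"
proof -
  have "(\<integral>\<^sup>+k. ennreal (f k) \<partial>measure_pmf (binomial_pmf n p))
      = (\<Sum>k\<le>n. ennreal (f k) * ennreal (pmf (binomial_pmf n p) k))"
    using assms set_pmf_binomial_eq[of p n]
    by (intro nn_integral_measure_pmf_support) (auto split: if_splits)
  also have "\<dots> = ennreal (\<Sum>k\<le>n. pmf (binomial_pmf n p) k * f k)"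
    by (subst sum_ennreal[symmetric])
       (auto simp: assms(2) ennreal_mult mult.commute intro!: sum.cong)
  finally show ?thesis .
qed

text \<open>
  Conditioned on the number of ones, a Bernoulli measure is uniform, and the number of ones has the
  binomial distribution.
\<close>

lemma nn_integral_bernoulli:
  assumes "p \<in> {0..1}" "\<And>x. 0 \<le> f x"
  shows "(\<integral>\<^sup>+x. ennreal (f x) \<partial>measure_pmf (bernoulli_measure n p))
    = ennreal (\<Sum>k\<le>n. pmf (binomial_pmf n p) k * ((\<Sum>x\<in>words n k. f x) / real (n choose k)))"
proof -
  have "(\<integral>\<^sup>+x. ennreal (f x) \<partial>measure_pmf (bernoulli_measure n p))
      = (\<Sum>x\<in>{x. length x = n}. ennreal (f x) * ennreal (pmf (bernoulli_measure n p) x))"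
    by (intro nn_integral_measure_pmf_support)
       (auto simp: bernoulli_measure_def set_replicate_pmf assms(2))
  also have "\<dots> = ennreal (\<Sum>x\<in>{x. length x = n}. f x * pmf (bernoulli_measure n p) x)"
    by (subst sum_ennreal[symmetric]) (auto simp: assms(2) ennreal_mult intro!: sum.cong)
  also have "{x :: bool list. length x = n} = (\<Union>k\<in>{..n}. words n k)"
    by (auto simp: words_def count_le_length)
  also have "(\<Sum>x\<in>\<dots>. f x * pmf (bernoulli_measure n p) x)
      = (\<Sum>k\<le>n. \<Sum>x\<in>words n k. f x * pmf (bernoulli_measure n p) x)"
    by (intro sum.UNION_disjoint) (auto simp: words_def)
  also have "\<dots> = (\<Sum>k\<le>n. pmf (binomial_pmf n p) k * ((\<Sum>x\<in>words n k. f x) / real (n choose k)))"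
  proof (intro sum.cong refl)
    fix k
    show "(\<Sum>x\<in>words n k. f x * pmf (bernoulli_measure n p) x)
        = pmf (binomial_pmf n p) k * ((\<Sum>x\<in>words n k. f x) / real (n choose k))"
      by (simp add: pmf_bernoulli_measure_eq_binomial[OF assms(1)] sum_distrib_left sum_distrib_right
          sum_divide_distrib mult.commute)
  qed
  finally show ?thesis .
qed

section \<open>Coding by subintervals of the unit interval\<close>

text \<open>
  One unbounded search followed by a total function: all description methods needed below have this
  form.
\<close>

lemma partial_computable_search:
  assumes P: "decidable (\<lambda>z. P (pfst z) (psnd z))"
    and out: "computable (\<lambda>z. out (pfst z) (psnd z))"
  shows "partial_computable (\<lambda>x. if \<exists>m. P x m then Some (out x (LEAST m. P x m)) else None)"
proof -
  have "computable (\<lambda>z. of_bool (\<not> P (pfst z) (psnd z)))"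
    using decidable_not[OF P] by (simp only: decidable_def)
  then obtain c where c: "\<And>h z. run c h z = Some (of_bool (\<not> P (pfst z) (psnd z)))"
    unfolding computable_def by blast
  obtain d where d: "\<And>h z. run d h z = Some (out (pfst z) (psnd z))"
    using out unfolding computable_def by blast
  have "run (Comp d (Tup (Tup Fst Snd) (Mu c))) (\<lambda>_. 0) x
      = (if \<exists>m. P x m then Some (out x (LEAST m. P x m)) else None)" for x
    by (simp add: c d)
  then show ?thesis unfolding partial_computable_def by blast
qed

text \<open>
  For a condition with code \<open>c\<close>, item \<open>t\<close> owns the interval between its two consecutive
  partial sums of the weights \<open>w c\<close>, in units of \<open>2 ^ - m c\<close>. The predicate says that it
  contains the dyadic interval from \<open>v / 2 ^ l\<close> to \<open>(v + 1) / 2 ^ l\<close>, which stands for the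
  program \<open>word l v\<close>; denominators are cleared. Items beyond the unit interval have no programs, so
  no truncation is needed when the weights are too large.
\<close>

definition codes_interval ::
  "(nat \<Rightarrow> nat) \<Rightarrow> (nat \<Rightarrow> nat \<Rightarrow> nat) \<Rightarrow> nat \<Rightarrow> nat \<Rightarrow> nat \<Rightarrow> nat \<Rightarrow> bool" where
  "codes_interval m w c l v t \<longleftrightarrow>
     (\<Sum>u<t. w c u) * 2 ^ l \<le> v * 2 ^ m c \<and> Suc v * 2 ^ m c \<le> (\<Sum>u<Suc t. w c u) * 2 ^ l"

lemma codes_interval_unique:
  assumes "codes_interval m w c l v t" "codes_interval m w c l v t'"
  shows "t = t'"
proof -
  have False if "codes_interval m w c l v t" "codes_interval m w c l v t'" "t < t'" for t t'
  proof -
    have "Suc v * 2 ^ m c \<le> (\<Sum>u<Suc t. w c u) * 2 ^ l"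
      using that(1) unfolding codes_interval_def by blast
    also have "\<dots> \<le> (\<Sum>u<t'. w c u) * 2 ^ l"
      using that(3) by (intro mult_right_mono sum_mono2) auto
    also have "\<dots> \<le> v * 2 ^ m c" using that(2) unfolding codes_interval_def by blast
    finally show False by simp
  qed
  then show ?thesis using assms by (metis linorder_neqE_nat)
qed

text \<open>
  The dyadic interval of an extension of a program is a subinterval. This is the reason for the prefix
  property.
\<close>

lemma codes_interval_extend:
  assumes "codes_interval m w c l (v div 2 ^ d) t"
  shows "codes_interval m w c (l + d) v t"
proof -
  have v: "v div 2 ^ d * 2 ^ d \<le> v" "Suc v \<le> Suc (v div 2 ^ d) * 2 ^ d"
    using div_times_less_eq_dividend[of v "2 ^ d"] dividend_less_div_times[of "2 ^ d" v] by simp_all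
  have "(\<Sum>u<t. w c u) * 2 ^ (l + d) = (\<Sum>u<t. w c u) * 2 ^ l * 2 ^ d"
    by (simp add: power_add)
  also have "\<dots> \<le> (v div 2 ^ d * 2 ^ m c) * 2 ^ d"
    using assms unfolding codes_interval_def by (intro mult_right_mono) auto
  also have "\<dots> = (v div 2 ^ d * 2 ^ d) * 2 ^ m c" by simp
  also have "\<dots> \<le> v * 2 ^ m c" using v(1) by (intro mult_right_mono) auto
  finally have lower: "(\<Sum>u<t. w c u) * 2 ^ (l + d) \<le> v * 2 ^ m c" .
  have "Suc v * 2 ^ m c \<le> (Suc (v div 2 ^ d) * 2 ^ d) * 2 ^ m c"
    using v(2) by (intro mult_right_mono) auto
  also have "\<dots> = (Suc (v div 2 ^ d) * 2 ^ m c) * 2 ^ d" by (simp only: mult_ac)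
  also have "\<dots> \<le> ((\<Sum>u<Suc t. w c u) * 2 ^ l) * 2 ^ d"
    using assms unfolding codes_interval_def by (intro mult_right_mono) auto
  also have "\<dots> = (\<Sum>u<Suc t. w c u) * 2 ^ (l + d)" by (simp only: power_add mult_ac)
  finally show ?thesis using lower unfolding codes_interval_def by blast
qed

text \<open>
  An interval of length \<open>2 ^ (g - m)\<close> contains a dyadic one of half that length.
\<close>

lemma ex_codes_interval:
  assumes total: "(\<Sum>u<Suc t. w c u) \<le> 2 ^ m c" and w: "2 ^ g \<le> w c t"
  shows "\<exists>v<2 ^ (m c - g + 1). codes_interval m w c (m c - g + 1) v t"
proof -
  define l where "l = m c - g + 1"
  define M :: nat where "M = 2 ^ m c"
  define S where "S = (\<Sum>u<t. w c u)"
  have M: "0 < M" by (simp add: M_def)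
  have "w c t \<le> (\<Sum>u<Suc t. w c u)" by simp
  with total w have "(2::nat) ^ g \<le> 2 ^ m c" by linarith
  then have "g \<le> m c" by simp
  then have double: "2 ^ g * 2 ^ l = 2 * M"
    by (simp add: l_def M_def power_add[symmetric])
  \<comment> \<open>\<open>S * 2 ^ l / M\<close> rounded up\<close>
  define v where "v = (S * 2 ^ l + (M - 1)) div M"
  have v_le: "v * M \<le> S * 2 ^ l + (M - 1)" unfolding v_def by (rule div_times_less_eq_dividend)
  have v_ge: "S * 2 ^ l + (M - 1) < v * M + M"
    unfolding v_def using dividend_less_div_times[OF M, of "S * 2 ^ l + (M - 1)"] by linarith
  have "Suc v * M \<le> S * 2 ^ l + 2 ^ g * 2 ^ l" using v_le M unfolding double by simp
  also have "\<dots> \<le> S * 2 ^ l + w c t * 2 ^ l" using w by simp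
  finally have upper: "Suc v * M \<le> (\<Sum>u<Suc t. w c u) * 2 ^ l"
    by (simp add: S_def add_mult_distrib)
  moreover have "S * 2 ^ l \<le> v * M" using v_ge M by linarith
  ultimately have "codes_interval m w c l v t"
    unfolding codes_interval_def S_def M_def by blast
  moreover have "v < 2 ^ l"
  proof -
    have "Suc v * M \<le> M * 2 ^ l" using upper total unfolding M_def
      by (meson mult_le_mono1 order_trans)
    then have "Suc v * M \<le> 2 ^ l * M" by (simp only: mult.commute)
    then have "Suc v \<le> 2 ^ l" using M by (simp only: mult_le_cancel2)
    then show ?thesis by simp
  qed
  ultimately show ?thesis unfolding l_def by blast
qed

text \<open>
  An effective version of the Shannon-Fano-Elias code: it needs the weights only in the order in which
  they are enumerated, and it may spend one bit more than their negative logarithms. The bound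
  holds for each item up to which the weights fit into the unit interval.
\<close>

theorem interval_coding:
  assumes m: "computable m" and w: "computable (\<lambda>z. w (pfst z) (psnd z))"
    and out: "computable (\<lambda>z. encode_obj (out (pfst z) (psnd z)))"
  obtains B where "prefix_method B"
    and "\<And>y t g. (\<Sum>u<Suc t. w (encode_obj y) u) \<le> 2 ^ m (encode_obj y) \<Longrightarrow>
      2 ^ g \<le> w (encode_obj y) t \<Longrightarrow>
      complexity B (out (encode_obj y) t) y \<le> enat (m (encode_obj y) - g + 1)"
proof -
  \<comment> \<open>\<open>x\<close> codes the program and the condition; \<open>z\<close> codes \<open>l\<close>, \<open>v\<close> and the item \<open>t\<close>\<close>
  define P where "P x z \<longleftrightarrow> word_code (pfst z) (pfst (psnd z)) = pfst x \<and>
      pfst (psnd z) < 2 ^ pfst z \<and>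
      codes_interval m w (psnd x) (pfst z) (pfst (psnd z)) (psnd (psnd z))" for x z
  define f where "f x = (if \<exists>z. P x z then Some (encode_obj (out (psnd x) (psnd (psnd (LEAST z. P x z))))) else None)" for x
  define B :: method_fun where "B q y = (let x = prod_encode (encode_word q, encode_obj y) in
      if \<exists>z. P x z then Some (out (encode_obj y) (psnd (psnd (LEAST z. P x z)))) else None)" for q y
  have P_iff: "P (prod_encode (encode_word q, c)) (prod_encode (l, prod_encode (v, t))) \<longleftrightarrow>
      word l v = q \<and> v < 2 ^ l \<and> codes_interval m w c l v t" for q c l v t
    by (simp add: P_def word_code_eq)
  have P_unique: "z = z'" if "P (prod_encode (encode_word q, c)) z" "P (prod_encode (encode_word q, c)) z'"
    for q c z z'
  proof -
    obtain l v t where z: "z = prod_encode (l, prod_encode (v, t))"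
      by (metis prod_decode_inverse surj_pair)
    obtain l' v' t' where z': "z' = prod_encode (l', prod_encode (v', t'))"
      by (metis prod_decode_inverse surj_pair)
    have "l = l'" using that unfolding z z' P_iff by (metis length_word)
    moreover have "v = v'" using that \<open>l = l'\<close> unfolding z z' P_iff by (metis word_inject)
    moreover have "t = t'" using that \<open>l = l'\<close> \<open>v = v'\<close> unfolding z z' P_iff
      by (metis codes_interval_unique)
    ultimately show ?thesis by (simp add: z z')
  qed
  have B_eq: "B q y = Some (out (encode_obj y) t)"
    if "word l v = q" "v < 2 ^ l" "codes_interval m w (encode_obj y) l v t" for q y l v t
  proof -
    let ?x = "prod_encode (encode_word q, encode_obj y)" and ?z = "prod_encode (l, prod_encode (v, t))"
    have z: "P ?x ?z" using that unfolding P_iff by blast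
    have "(LEAST z. P ?x z) = ?z"
      using z P_unique[of q "encode_obj y"] by (metis LeastI)
    with z show ?thesis unfolding B_def Let_def by auto
  qed
  have B_cases: "\<exists>l v t. word l v = q \<and> v < 2 ^ l \<and> codes_interval m w (encode_obj y) l v t \<and>
      x = out (encode_obj y) t" if "B q y = Some x" for q y x
  proof -
    obtain z where P: "P (prod_encode (encode_word q, encode_obj y)) z"
      using \<open>B q y = Some x\<close> unfolding B_def Let_def by (auto split: if_splits)
    obtain l v t where z: "z = prod_encode (l, prod_encode (v, t))"
      by (metis prod_decode_inverse surj_pair)
    have *: "word l v = q" "v < 2 ^ l" "codes_interval m w (encode_obj y) l v t"
      using P unfolding z P_iff by auto
    with B_eq[OF *] that show ?thesis by auto
  qed
  have "description_method B"
    unfolding description_method_def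
  proof (intro exI[of _ f] conjI allI)
    show "partial_computable f"
      unfolding f_def
    proof (rule partial_computable_search[of P "\<lambda>x z. encode_obj (out (psnd x) (psnd (psnd z)))"])
      show "decidable (\<lambda>z. P (pfst z) (psnd z))"
        unfolding P_def codes_interval_def
        by (intro computable_intros computable_comp[OF m] computable_comp2[OF w])
      show "computable (\<lambda>z. encode_obj (out (psnd (pfst z)) (psnd (psnd (psnd z)))))"
        by (rule computable_comp2[OF out]; intro computable_intros)
    qed
    show "f (prod_encode (encode_word q, encode_obj y)) = map_option encode_obj (B q y)" for q y
      unfolding f_def B_def Let_def by simp
  qed
  moreover have "B q' y = Some x" if pre: "prefix q q'" and Bq: "B q y = Some x" for q q' y x
  proof -
    obtain l v t where q: "word l v = q" "v < 2 ^ l" "codes_interval m w (encode_obj y) l v t"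
      "x = out (encode_obj y) t"
      using B_cases[OF Bq] by blast
    define d where "d = length q' - l"
    have "length q = l" using q(1) by auto
    then have len: "length q' = l + d" using prefix_length_le[OF pre] by (simp add: d_def)
    obtain v' where v': "v' < 2 ^ (l + d)" "word (l + d) v' = q'"
      using ex_word[OF len] by blast
    have "q = take l q'" using pre \<open>length q = l\<close> by (auto simp: prefix_def)
    also have "\<dots> = word l (v' div 2 ^ d)" using v'(2) take_word[of l d v'] by simp
    finally have "word l v = word l (v' div 2 ^ d)" using q(1) by simp
    moreover have "v' div 2 ^ d < 2 ^ l"
      using v'(1) by (simp add: less_mult_imp_div_less power_add)
    ultimately have "v = v' div 2 ^ d" using q(2) by (intro word_inject)
    then have "codes_interval m w (encode_obj y) (l + d) v' t"
      using q(3) by (intro codes_interval_extend) simp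
    from B_eq[OF v'(2,1) this] show ?thesis using q(4) by simp
  qed
  ultimately have "prefix_method B" unfolding prefix_method_def by blast
  moreover have "complexity B (out (encode_obj y) t) y \<le> enat (m (encode_obj y) - g + 1)"
    if total: "(\<Sum>u<Suc t. w (encode_obj y) u) \<le> 2 ^ m (encode_obj y)"
      and g: "2 ^ g \<le> w (encode_obj y) t" for y t g
  proof -
    obtain v where v: "v < 2 ^ (m (encode_obj y) - g + 1)"
      "codes_interval m w (encode_obj y) (m (encode_obj y) - g + 1) v t"
      using ex_codes_interval[of w "encode_obj y" t m g, OF total g] by blast
    from complexity_le[of B, OF B_eq[OF refl v]] show ?thesis by simp
  qed
  ultimately show ?thesis using that by blast
qed

section \<open>Describing words whose stage weights are summable\<close>

text \<open>
  The increase of \<open>2 ^ f s\<close> at stage \<open>s\<close>. As weights, the increments telescope, so that a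
  growing approximation uses up no more than its final value.
\<close>

definition stage_increment :: "(nat \<Rightarrow> nat) \<Rightarrow> nat \<Rightarrow> nat" where
  "stage_increment f s = 2 ^ f s - (if s = 0 then 0 else 2 ^ f (s - 1))"

lemma sum_stage_increment:
  assumes "mono f"
  shows "(\<Sum>s<Suc t. stage_increment f s) = 2 ^ f t"
proof (induction t)
  case (Suc t)
  have "f t \<le> f (Suc t)" using assms by (simp add: monoD)
  then have "(2::nat) ^ f t \<le> 2 ^ f (Suc t)" by simp
  with Suc show ?case by (simp add: stage_increment_def)
qed (simp add: stage_increment_def)

text \<open>
  At the first stage where \<open>f\<close> reaches \<open>f s\<close> the increment is the whole power if this is
  stage 0; otherwise \<open>f\<close> grows there, so the power at least doubles and the increment is at least
  half of its new value.
\<close>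

lemma ex_large_stage_increment:
  fixes f :: "nat \<Rightarrow> nat"
  shows "\<exists>t\<le>s. 2 ^ (f s - 1) \<le> stage_increment f t"
proof -
  define t where "t = (LEAST t. f s \<le> f t)"
  have t: "f s \<le> f t" unfolding t_def by (rule LeastI[of _ s]) simp
  have "t \<le> s" unfolding t_def by (rule Least_le) simp
  moreover have "2 ^ (f s - 1) \<le> stage_increment f t"
  proof (cases t)
    case 0
    have "(2::nat) ^ (f s - 1) \<le> 2 ^ f 0" using t 0 by simp
    then show ?thesis by (simp add: stage_increment_def 0)
  next
    case (Suc u)
    have "\<not> f s \<le> f u" using not_less_Least[of u "\<lambda>t. f s \<le> f t"] Suc by (simp add: t_def)
    then have le: "f u \<le> f s - 1" "0 < f s" by auto
    have "(2::nat) ^ f u \<le> 2 ^ (f s - 1)" using le by simp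
    moreover have "(2::nat) * 2 ^ (f s - 1) = 2 ^ f s" using le by (simp add: power_eq_if)
    moreover have "(2::nat) ^ f s \<le> 2 ^ f t" using t by simp
    ultimately have "2 ^ (f s - 1) \<le> (2::nat) ^ f t - 2 ^ f u" by linarith
    then show ?thesis by (simp add: stage_increment_def Suc)
  qed
  ultimately show ?thesis by blast
qed

text \<open>
  Head and tail on the codes given by \<open>list_encode\<close>.
\<close>

abbreviation code_tl :: "nat \<Rightarrow> nat" where "code_tl z \<equiv> psnd (z - 1)"
abbreviation code_hd :: "nat \<Rightarrow> nat" where "code_hd z \<equiv> pfst (z - 1)"

text \<open>
  The items of the interval code are pairs of a stage and a word, and their weights are the increments
  of \<open>2 ^ G\<close>. The condition \<open>d\<close> carries the exponent of the normalising factor; the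
  hypothesis on the sums says that this factor is large enough, which is true for the intended
  \<open>d\<close> but of course not for all of them.
\<close>

lemma complexity_le_of_summable_stages:
  assumes A: "optimal_prefix_method A"
    and G: "computable (\<lambda>z. G (pfst z) (pfst (psnd z)) (psnd (psnd z)))" "\<And>n a. mono (G n a)"
  shows "\<exists>C. \<forall>n k d x s. x \<in> words n k \<longrightarrow>
    (\<forall>s. (\<Sum>x\<in>words n k. 2 ^ G n (encode_word x) s) \<le> 2 ^ (shifted_value c d + K) * (n choose k)) \<longrightarrow>
    (\<exists>l. complexity A (Word x) (NatSeq [n, k, d]) = enat l \<and>
      l + G n (encode_word x) s \<le> shifted_value c d + floor_log2 (n choose k) + C)"
proof -
  define hn hk hd' where "hn z = code_hd (psnd z)" and "hk z = code_hd (code_tl (psnd z))"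
    and "hd' z = code_hd (code_tl (code_tl (psnd z)))" for z
  define m where "m z = shifted_value c (hd' z) + K + floor_log2 (hn z choose hk z) + 1" for z
  define w where "w z t = (if ones (hn z) (t mod 2 ^ hn z) = hk z
      then stage_increment (G (hn z) (word_code (hn z) (t mod 2 ^ hn z))) (t div 2 ^ hn z) else 0)" for z t
  define out where "out z t = Word (word (hn z) (t mod 2 ^ hn z))" for z t
  have "computable m"
    unfolding m_def hn_def hk_def hd'_def shifted_value_def by (intro computable_intros)
  moreover have "computable (\<lambda>z. w (pfst z) (psnd z))"
    unfolding w_def hn_def hk_def stage_increment_def
    by (intro computable_intros computable_comp3[OF G(1)])
  moreover have "computable (\<lambda>z. encode_obj (out (pfst z) (psnd z)))"
    unfolding out_def hn_def encode_obj.simps word_code_eq[symmetric] by (intro computable_intros)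
  ultimately obtain B where B: "prefix_method B"
    "\<And>y t g. (\<Sum>u<Suc t. w (encode_obj y) u) \<le> 2 ^ m (encode_obj y) \<Longrightarrow>
      2 ^ g \<le> w (encode_obj y) t \<Longrightarrow>
      complexity B (out (encode_obj y) t) y \<le> enat (m (encode_obj y) - g + 1)"
    using interval_coding by blast
  obtain C where C: "\<And>x y. complexity A x y \<le> complexity B x y + enat C"
    using A B(1) unfolding optimal_prefix_method_def by blast
  have "\<exists>l. complexity A (Word x) (NatSeq [n, k, d]) = enat l \<and>
      l + G n (encode_word x) s \<le> shifted_value c d + floor_log2 (n choose k) + (K + 3 + C)"
    if x: "x \<in> words n k"
      and bound: "\<forall>s. (\<Sum>x\<in>words n k. 2 ^ G n (encode_word x) s) \<le> 2 ^ (shifted_value c d + K) * (n choose k)"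
    for n k d x s
  proof -
    let ?y = "NatSeq [n, k, d]"
    let ?z = "encode_obj ?y"
    have hs: "hn ?z = n" "hk ?z = k" "hd' ?z = d"
      by (simp_all add: hn_def hk_def hd'_def)
    have len: "length x = n" "count_list x True = k" using x by (auto simp: words_def)
    obtain i where i: "i < 2 ^ n" "word n i = x" using ex_word[OF len(1)] by blast
    then have ones_i: "ones n i = k" and code_i: "word_code n i = encode_word x"
      by (simp_all add: ones_eq len word_code_eq)
    define g where "g = G n (encode_word x) s"
    obtain r where r: "2 ^ (g - 1) \<le> stage_increment (G n (encode_word x)) r"
      unfolding g_def using ex_large_stage_increment by blast
    \<comment> \<open>item number \<open>t\<close> is word \<open>i\<close> at stage \<open>r\<close>\<close>
    define t where "t = r * 2 ^ n + i"
    have t: "t mod 2 ^ n = i" "t div 2 ^ n = r"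
      using i by (simp_all add: t_def)
    have w_t: "w ?z t = stage_increment (G n (encode_word x)) r"
      unfolding w_def hs t using ones_i code_i by simp
    have out_t: "out ?z t = Word x" unfolding out_def hs t by (simp add: i)
    have "(\<Sum>u<Suc t. w ?z u) \<le> (\<Sum>u<Suc r * 2 ^ n. w ?z u)"
      using i by (intro sum_mono2) (auto simp: t_def)
    also have "\<dots> = (\<Sum>s<Suc r. \<Sum>u\<in>{s * 2 ^ n..<s * 2 ^ n + 2 ^ n}. w ?z u)"
      by (rule sum.nat_group[symmetric])
    also have "\<dots> = (\<Sum>s<Suc r. \<Sum>i<2 ^ n. w ?z (s * 2 ^ n + i))"
    proof (rule sum.cong[OF refl])
      fix s
      show "(\<Sum>u\<in>{s * 2 ^ n..<s * 2 ^ n + 2 ^ n}. w ?z u) = (\<Sum>i<2 ^ n. w ?z (s * 2 ^ n + i))"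
        using sum.shift_bounds_nat_ivl[of "w ?z" 0 "s * 2 ^ n" "2 ^ n"]
        by (simp add: lessThan_atLeast0 add.commute)
    qed
    also have "\<dots> = (\<Sum>i<2 ^ n. \<Sum>s<Suc r. w ?z (s * 2 ^ n + i))" by (rule sum.swap)
    also have "\<dots> = (\<Sum>i<2 ^ n. if ones n i = k then 2 ^ G n (encode_word (word n i)) r else 0)"
    proof (rule sum.cong[OF refl])
      fix i :: nat assume "i \<in> {..<2 ^ n}"
      then have "w ?z (s * 2 ^ n + i) =
          (if ones n i = k then stage_increment (G n (word_code n i)) s else 0)" for s
        unfolding w_def hs by simp
      then show "(\<Sum>s<Suc r. w ?z (s * 2 ^ n + i)) = (if ones n i = k then 2 ^ G n (encode_word (word n i)) r else 0)"
        using sum_stage_increment[OF G(2), of n "word_code n i" r] by (simp add: word_code_eq)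
    qed
    also have "\<dots> = (\<Sum>x\<in>words n k. 2 ^ G n (encode_word x) r)" by (rule sum_words[symmetric])
    also have "\<dots> \<le> 2 ^ (shifted_value c d + K) * (n choose k)" using bound by blast
    also have "\<dots> \<le> 2 ^ (shifted_value c d + K) * 2 ^ Suc (floor_log2 (n choose k))"
    proof (intro mult_left_mono)
      have "0 < n choose k" using len count_le_length[of x True] by simp
      then show "n choose k \<le> 2 ^ Suc (floor_log2 (n choose k))" using floor_log2_bounds(2) less_imp_le by blast
    qed simp
    also have "\<dots> = 2 ^ m ?z" unfolding m_def hs by (simp add: power_add)
    finally have total: "(\<Sum>u<Suc t. w ?z u) \<le> 2 ^ m ?z" .
    have "2 ^ (g - 1) \<le> w ?z t" using r w_t by simp
    from B(2)[OF total this] have B_le: "complexity B (Word x) ?y \<le> enat (m ?z - (g - 1) + 1)"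
      unfolding out_t .
    have "w ?z t \<le> (\<Sum>u<Suc t. w ?z u)" by simp
    with total \<open>2 ^ (g - 1) \<le> w ?z t\<close> have "(2::nat) ^ (g - 1) \<le> 2 ^ m ?z" by linarith
    then have g_le: "g - 1 \<le> m ?z" by simp
    have "complexity A (Word x) ?y \<le> enat (m ?z - (g - 1) + 1) + enat C"
      using C[of "Word x" ?y] B_le by (meson add_right_mono order_trans)
    then have "complexity A (Word x) ?y \<le> enat (m ?z - (g - 1) + 1 + C)" by simp
    then obtain l where l: "complexity A (Word x) ?y = enat l" "l \<le> m ?z - (g - 1) + 1 + C"
      using enat_ile by fastforce
    have "m ?z = shifted_value c d + K + floor_log2 (n choose k) + 1" unfolding m_def hs ..
    with l(2) g_le have "l + g \<le> shifted_value c d + floor_log2 (n choose k) + (K + 3 + C)" by linarith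
    with l(1) show ?thesis unfolding g_def by blast
  qed
  then show ?thesis by blast
qed

section \<open>Limits of stages as tests\<close>

lemma mono_bounded_Max:
  fixes f :: "nat \<Rightarrow> nat"
  assumes "\<And>s. f s \<le> b"
  shows "f s \<le> Max (range f)" "\<exists>s. f s = Max (range f)"
proof -
  have "range f \<subseteq> {..b}" using assms by blast
  then have fin: "finite (range f)" by (rule finite_subset) simp
  then show "f s \<le> Max (range f)" by (rule Max_ge) simp
  have "Max (range f) \<in> range f" using fin by (rule Max_in) simp
  then obtain t where "Max (range f) = f t" by (rule rangeE)
  then show "\<exists>s. f s = Max (range f)" by (intro exI[of _ t]) simp
qed

definition shifted_encode :: "nat \<Rightarrow> nat \<Rightarrow> nat" where
  "shifted_encode c v = (if c \<le> v then 2 * (v - c) else Suc (2 * (c - v - 1)))"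

lemma shifted_encode_eq: "shifted_encode c v = int_encode (int v - int c)"
proof (cases "c \<le> v")
  case True
  then have "nat (int v - int c) = v - c" by linarith
  with True show ?thesis by (simp add: shifted_encode_def int_encode_def sum_encode_def)
next
  case False
  then have "nat (int c - int v - 1) = c - v - 1" by linarith
  with False show ?thesis by (simp add: shifted_encode_def int_encode_def sum_encode_def)
qed

text \<open>
  For bounded stages the limit is a maximum. The test ignores \<open>p\<close>, so its program ignores the
  oracle.
\<close>

lemma is_test_of_stages:
  assumes G: "computable (\<lambda>z. G (pfst z) (pfst (psnd z)) (psnd (psnd z)))"
    and mono: "\<And>n a. mono (G n a)"
    and bound: "\<And>n x s. 0 < n \<Longrightarrow> x \<in> S n \<Longrightarrow> G n (e x) s \<le> b n x"
    and mean: "\<And>n p. 0 < n \<Longrightarrow> p \<in> {0..1} \<Longrightarrow>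
      (\<integral>\<^sup>+x. ennreal (2 powr (real (Max (range (G n (e x)))) - real C)) \<partial>measure_pmf (M n p)) \<le> 1"
  shows "is_test S M e (\<lambda>n p x. ereal (real (Max (range (G n (e x)))) - real C))"
proof -
  have integral_values: "ereal (real (Max (range (G n (e x)))) - real C) \<in>
      insert \<infinity> (range (\<lambda>z::int. ereal (of_int z)))" for n x
    by (intro insertI2 range_eqI[of _ _ "int (Max (range (G n (e x)))) - int C"]) simp
  have "computable (\<lambda>z. shifted_encode C (G (pfst z) (pfst (psnd z)) (psnd (psnd z))))"
    unfolding shifted_encode_def by (intro computable_intros G)
  then obtain c where c: "\<And>h z. run c h z
      = Some (shifted_encode C (G (pfst z) (pfst (psnd z)) (psnd (psnd z))))"
    unfolding computable_def by blast
  have lsc: "lower_semicomputable S e (\<lambda>n p x. ereal (real (Max (range (G n (e x)))) - real C))"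
    unfolding lower_semicomputable_def
  proof (intro exI[of _ c] allI ballI impI)
    fix n p x a
    assume n: "0 < n" and x: "x \<in> S n"
    let ?f = "G n (e x)"
    let ?m = "\<lambda>j. int (?f j) - int C"
    note f = mono_bounded_Max[of ?f, OF bound[OF n x]]
    have "mono ?m" using mono[of n "e x"] by (auto simp: mono_def)
    moreover have "run c (\<lambda>i. encode_rat (a i)) (prod_encode (n, prod_encode (e x, j)))
        = Some (int_encode (?m j))" for j
      by (simp add: c shifted_encode_eq)
    moreover have "(SUP j. ereal (of_int (?m j))) = ereal (real (Max (range ?f)) - real C)"
    proof (rule antisym)
      show "(SUP j. ereal (of_int (?m j))) \<le> ereal (real (Max (range ?f)) - real C)"
        using f(1) by (intro SUP_least) simp
      obtain s where "?f s = Max (range ?f)" using f(2) by blast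
      then show "ereal (real (Max (range ?f)) - real C) \<le> (SUP j. ereal (of_int (?m j)))"
        by (intro SUP_upper2[of s]) auto
    qed
    ultimately show "\<exists>m :: nat \<Rightarrow> int. mono m \<and>
        (\<forall>j. run c (\<lambda>i. encode_rat (a i)) (prod_encode (n, prod_encode (e x, j)))
          = Some (int_encode (m j))) \<and>
        (SUP j. ereal (of_int (m j))) = ereal (real (Max (range ?f)) - real C)"
      by blast
  qed
  have exp2_ereal: "exp2 (ereal r) = ennreal (2 powr r)" for r by (simp add: exp2_def)
  show ?thesis
    unfolding is_test_def exp2_ereal
  proof (intro conjI)
    show "\<forall>n>0. \<forall>p\<in>{0..1}. \<forall>x\<in>S n. ereal (real (Max (range (G n (e x)))) - real C) \<in>
        insert \<infinity> (range (\<lambda>z::int. ereal (of_int z)))"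
      using integral_values by blast
    show "\<forall>n>0. \<forall>p\<in>{0..1}. (\<integral>\<^sup>+x. ennreal (2 powr (real (Max (range (G n (e x)))) - real C)) \<partial>measure_pmf (M n p)) \<le> 1"
      using mean by blast
  qed (rule lsc)
qed

text \<open>
  Because \<open>0\<close> is a test.
\<close>

lemma universal_test_bounded_below:
  assumes "universal_test S M e D"
  obtains C :: nat where
    "\<And>n p x. 0 < n \<Longrightarrow> p \<in> {0..1} \<Longrightarrow> x \<in> S n \<Longrightarrow> - ereal C \<le> D n p x"
proof -
  have range: "range (\<lambda>_ :: nat. 0 :: nat) = {0}" by auto
  have "is_test S M e (\<lambda>n p x. ereal (real (Max (range (\<lambda>_ :: nat. 0 :: nat))) - real (0 :: nat)))"
  proof (rule is_test_of_stages[where G = "\<lambda>_ _ _. 0" and C = 0 and b = "\<lambda>_ _. 0"])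
    show "computable (\<lambda>z. 0)" by (rule computable_const)
    show "(\<integral>\<^sup>+x. ennreal (2 powr (real (Max (range (\<lambda>_ :: nat. 0 :: nat))) - real (0 :: nat))) \<partial>measure_pmf (M n p)) \<le> 1"
      for n p unfolding range by simp
  qed (simp_all add: mono_def)
  then have "is_test S M e (\<lambda>n p x. 0)" unfolding range by (simp add: zero_ereal_def)
  then obtain C :: real where C: "\<forall>n>0. \<forall>p\<in>{0..1}. \<forall>x\<in>S n. D n p x \<ge> 0 - ereal C"
    using assms unfolding universal_test_def by blast
  show ?thesis
  proof (rule that[of "nat \<lceil>C\<rceil>"])
    fix n :: nat and p :: real and x
    assume "0 < n" "p \<in> {0..1}" "x \<in> S n"
    then have "- ereal C \<le> D n p x" using C by simp
    moreover have "C \<le> real (nat \<lceil>C\<rceil>)" by linarith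
    then have "- ereal (real (nat \<lceil>C\<rceil>)) \<le> - ereal C" by simp
    ultimately show "- ereal (real (nat \<lceil>C\<rceil>)) \<le> D n p x" by (rule order_trans[rotated])
  qed
qed

lemma nn_integral_pmf_infinite:
  assumes "f x = \<infinity>" "0 < pmf N x"
  shows "(\<integral>\<^sup>+x. f x \<partial>measure_pmf N) = \<infinity>"
proof -
  have "(\<integral>\<^sup>+y. \<infinity> * indicator {x} y \<partial>measure_pmf N) \<le> (\<integral>\<^sup>+x. f x \<partial>measure_pmf N)"
    using assms(1) by (intro nn_integral_mono) (auto simp: indicator_def)
  moreover have "(\<integral>\<^sup>+y. \<infinity> * indicator {x} y \<partial>measure_pmf N) = \<infinity>"
    using assms(2) by (subst nn_integral_cmult_indicator) (auto simp: emeasure_pmf_single ennreal_top_mult)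
  ultimately show ?thesis by (simp add: top_unique)
qed

text \<open>
  The infimum is finite because an outcome of positive probability has finite deficiency, and it is
  attained because the values are integers; \<open>g - C\<close> is the infimum and \<open>G\<close> its
  approximation from below.
\<close>

theorem inf_of_universal_test:
  assumes D: "universal_test S M e D"
    and pos: "\<And>n x. 0 < n \<Longrightarrow> x \<in> S n \<Longrightarrow> \<exists>p\<in>{0..1}. 0 < pmf (M n p) x"
  obtains G g C where
    "computable (\<lambda>z. G (pfst z) (pfst (psnd z)) (psnd (psnd z)))"
    and "\<And>n a. mono (G n a)"
    and "\<And>n x. 0 < n \<Longrightarrow> x \<in> S n \<Longrightarrow>
      (INF p\<in>{0..1}. D n p x) = ereal (real (g n x) - real C)"
    and "\<And>n x s. 0 < n \<Longrightarrow> x \<in> S n \<Longrightarrow> G n (e x) s \<le> g n x"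
    and "\<And>n x. 0 < n \<Longrightarrow> x \<in> S n \<Longrightarrow> \<exists>s. G n (e x) s = g n x"
proof -
  have test: "is_test S M e D" using D unfolding universal_test_def by blast
  obtain C :: nat where C:
    "\<And>n p x. 0 < n \<Longrightarrow> p \<in> {0..1} \<Longrightarrow> x \<in> S n \<Longrightarrow> - ereal C \<le> D n p x"
    using universal_test_bounded_below[OF D] by blast
  have lsc: "lower_semicomputable S e D" using test unfolding is_test_def by blast
  obtain G where G: "computable (\<lambda>z. G (pfst z) (pfst (psnd z)) (psnd (psnd z)))"
    "\<And>n k. mono (G n k)"
    "\<And>n x v. 0 < n \<Longrightarrow> x \<in> S n \<Longrightarrow>
      (\<exists>s. v \<le> G n (e x) s) \<longleftrightarrow> (\<forall>p\<in>{0..1}. ereal (real v) - ereal C \<le> D n p x)"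
    using inf_over_parameter_enumerable[where C = C, OF lsc C] by blast
  define g where "g n x = Max (range (G n (e x)))" for n x
  have main: "(INF p\<in>{0..1}. D n p x) = ereal (real (g n x) - real C) \<and>
      (\<forall>s. G n (e x) s \<le> g n x) \<and> (\<exists>s. G n (e x) s = g n x)"
    if n: "0 < n" and x: "x \<in> S n" for n x
  proof -
    obtain q where q: "q \<in> {0..1}" "0 < pmf (M n q) x" using pos[OF n x] by blast
    have "D n q x \<noteq> \<infinity>"
    proof
      assume "D n q x = \<infinity>"
      then have "exp2 (D n q x) = \<infinity>" by (simp add: exp2_def)
      from nn_integral_pmf_infinite[of "\<lambda>x. exp2 (D n q x)", OF this q(2)]
      have "(\<integral>\<^sup>+x. exp2 (D n q x) \<partial>measure_pmf (M n q)) = \<infinity>" .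
      moreover have "(\<integral>\<^sup>+x. exp2 (D n q x) \<partial>measure_pmf (M n q)) \<le> 1"
        using test n q(1) unfolding is_test_def by blast
      ultimately show False by (simp add: top_unique)
    qed
    moreover have "D n q x \<noteq> - \<infinity>" using C[OF n q(1) x] by auto
    ultimately obtain r where r: "D n q x = ereal r" by (cases "D n q x") auto
    have "G n (e x) s \<le> nat \<lceil>r + real C\<rceil>" for s
    proof -
      have "ereal (real (G n (e x) s)) - ereal C \<le> D n q x" using G(3)[OF n x] q(1) by blast
      then have "real (G n (e x) s) \<le> r + real C" by (simp add: r)
      then show ?thesis by linarith
    qed
    note g = mono_bounded_Max[of "G n (e x)", OF this, folded g_def]
    have lower: "\<forall>p\<in>{0..1}. ereal (real (g n x)) - ereal C \<le> D n p x"
      using G(3)[OF n x, of "g n x"] g(2) by (metis order_refl)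
    have "\<not> (\<exists>s. Suc (g n x) \<le> G n (e x) s)" using g(1) by (simp add: not_le less_Suc_eq_le)
    then obtain p where p: "p \<in> {0..1}" "\<not> ereal (real (Suc (g n x))) - ereal C \<le> D n p x"
      using G(3)[OF n x, of "Suc (g n x)"] by blast
    moreover have "D n p x \<in> insert \<infinity> (range (\<lambda>z::int. ereal (of_int z)))"
      using test n p(1) x unfolding is_test_def by blast
    ultimately obtain z :: int where z: "D n p x = ereal (of_int z)" by auto
    have "real_of_int z < real (Suc (g n x)) - real C" using p(2) unfolding z by simp
    then have "z < int (Suc (g n x)) - int C" by linarith
    then have "real_of_int z \<le> real (g n x) - real C" by linarith
    then have "D n p x \<le> ereal (real (g n x) - real C)" by (simp add: z)
    then have "(INF p\<in>{0..1}. D n p x) \<le> ereal (real (g n x) - real C)"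
      using p(1) by (rule INF_lower2[rotated])
    moreover have "ereal (real (g n x) - real C) \<le> (INF p\<in>{0..1}. D n p x)"
      using lower by (intro INF_greatest) simp
    ultimately show ?thesis using g by (auto intro: antisym)
  qed
  show ?thesis
    by (rule that[OF G(1,2), of g C]) (use main in blast)+
qed

text \<open>
  The witness \<open>k / n\<close> also works for \<open>k = 0\<close> and \<open>k = n\<close>, as \<open>0 ^ 0 = 1\<close>.
\<close>

lemma ex_positive_binomial:
  assumes "0 < n" "k \<le> n"
  shows "\<exists>p\<in>{0..1}. 0 < pmf (binomial_pmf n p) k"
proof
  let ?p = "real k / real n"
  show p: "?p \<in> {0..1}" using assms by auto
  have "0 < ?p ^ k" using assms by (cases "k = 0") auto
  moreover have "0 < (1 - ?p) ^ (n - k)" using assms by (cases "k = n") auto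
  ultimately show "0 < pmf (binomial_pmf n ?p) k" using assms p by simp
qed

section \<open>Lower bound for the Bernoulli deficiency\<close>

lemma sum_power2_le: "(\<Sum>j<Suc b. (2::real) ^ j) \<le> 2 ^ Suc b"
  by (induction b) auto

text \<open>
  Here \<open>g\<close> is the binomial deficiency shifted by \<open>c\<close>. The test is the largest value of
  \<open>j + log (n choose k) - |q| - (c + 2)\<close>, where \<open>j \<le> g n k\<close> and \<open>q\<close> is a program for
  \<open>x\<close> given \<open>n\<close>, \<open>k\<close> and the unshifted \<open>j - c\<close>. It is at least
  \<open>- (c + 2)\<close>, the value when no program helps; this default costs the summand 1 in
  \<open>L_weight\<close>. The constant \<open>c + 2\<close> absorbs the shift and the factor 4 that bounds
  \<open>1 + 2 * 2 ^ g\<close> by \<open>4 * 2 ^ g\<close>.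
\<close>

theorem described_words_test:
  assumes A: "prefix_method A" and D': "is_test (\<lambda>n. {0..n}) binomial_pmf (\<lambda>k. k) D'"
    and G: "computable (\<lambda>z. G (pfst z) (pfst (psnd z)) (psnd (psnd z)))"
    and mono: "\<And>n k. mono (G n k)"
    and G_le: "\<And>n k s. 0 < n \<Longrightarrow> k \<le> n \<Longrightarrow> G n k s \<le> g n k"
    and G_eq: "\<And>n k. 0 < n \<Longrightarrow> k \<le> n \<Longrightarrow> \<exists>s. G n k s = g n k"
    and g: "\<And>n p k. 0 < n \<Longrightarrow> p \<in> {0..1} \<Longrightarrow> k \<le> n \<Longrightarrow> ereal (real (g n k) - real c) \<le> D' n p k"
  obtains T where
    "is_test (\<lambda>n. {x. length x = n}) bernoulli_measure encode_word T"
    and "\<And>n p x q. 0 < n \<Longrightarrow> length x = n \<Longrightarrow>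
      A q (NatSeq [n, count_list x True, int_encode (int (g n (count_list x True)) - int c)]) = Some (Word x) \<Longrightarrow>
      ereal (real (g n (count_list x True)) + real (floor_log2 (n choose count_list x True))
        - real (length q) - real (c + 2)) \<le> T n p x"
proof -
  obtain a where a: "\<And>q y. run a (\<lambda>_. 0) (prod_encode (encode_word q, encode_obj y)) = map_option encode_obj (A q y)"
    using A unfolding prefix_method_def description_method_def partial_computable_def by metis
  \<comment> \<open>the code of the condition \<open>n, k, j - c\<close>, written out so that it is visibly computable\<close>
  define cond where "cond n k j = prod_encode (1, Suc (prod_encode (n, Suc (prod_encode (k,
    Suc (prod_encode (shifted_encode c j, 0)))))))" for n k j
  have cond: "cond n k j = encode_obj (NatSeq [n, k, int_encode (int j - int c)])" for n k j
    by (simp add: cond_def shifted_encode_eq)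
  \<comment> \<open>the number of ones is not part of the input; it is found by searching for the word with code \<open>w\<close>\<close>
  define Q where "Q n w v s \<longleftrightarrow> (\<exists>i<2 ^ n. word_code n i = w \<and>
    (\<exists>j<Suc (G n (ones n i) s). \<exists>l<Suc s. \<exists>u<2 ^ l.
      fuel_run0 a s (prod_encode (word_code l u, cond n (ones n i) j)) = Suc (prod_encode (0, w)) \<and>
      v + l \<le> j + floor_log2 (n choose ones n i)))" for n w v s
  define N where "N n w s = stage_count (Q n w) s" for n w s
  have Q_words: "Q n (encode_word x) v s \<longleftrightarrow> (\<exists>j\<le>G n (count_list x True) s. \<exists>q. length q \<le> s \<and>
      fuel_run0 a s (prod_encode (encode_word q, cond n (count_list x True) j)) = Suc (encode_obj (Word x)) \<and>
      v + length q \<le> j + floor_log2 (n choose count_list x True))" (is "_ \<longleftrightarrow> ?R")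
    if x: "length x = n" for n x v s
  proof -
    obtain i where i: "i < 2 ^ n" "word n i = x" using ex_word[OF x] by blast
    have code: "word_code n i' = encode_word x \<longleftrightarrow> i' = i" if "i' < 2 ^ n" for i'
      using i that by (auto simp: word_code_eq dest: word_inject)
    have "Q n (encode_word x) v s \<longleftrightarrow>
      (\<exists>j<Suc (G n (ones n i) s). \<exists>l<Suc s. \<exists>u<2 ^ l.
      fuel_run0 a s (prod_encode (word_code l u, cond n (ones n i) j)) = Suc (prod_encode (0, encode_word x)) \<and>
      v + l \<le> j + floor_log2 (n choose ones n i))"
      unfolding Q_def using i(1) code by blast
    also have "\<dots> \<longleftrightarrow> ?R"
    proof -
      have *: "(\<exists>l<Suc s. \<exists>u<2 ^ l. P (word_code l u) l) \<longleftrightarrow> (\<exists>q. length q \<le> s \<and> P (encode_word q) (length q))"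
        for P :: "nat \<Rightarrow> nat \<Rightarrow> bool"
        unfolding word_code_eq less_Suc_eq_le using ex_word by (metis length_word)
      show ?thesis
        unfolding ones_eq i(2) encode_obj.simps
          *[of "\<lambda>b l. fuel_run0 a s (prod_encode (b, cond n (count_list x True) j)) = Suc (prod_encode (0, encode_word x)) \<and>
            v + l \<le> j + floor_log2 (n choose count_list x True)" for j]
        unfolding less_Suc_eq_le ..
    qed
    finally show ?thesis .
  qed
  have Q_antimono: "Q n w v s" if le: "v \<le> v'" and Q: "Q n w v' s" for n w v v' s
  proof -
    obtain i j l u where i: "i < 2 ^ n" "word_code n i = w" and j: "j < Suc (G n (ones n i) s)"
      and l: "l < Suc s" "u < 2 ^ l"
      "fuel_run0 a s (prod_encode (word_code l u, cond n (ones n i) j)) = Suc (prod_encode (0, w))"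
      "v' + l \<le> j + floor_log2 (n choose ones n i)"
      using Q unfolding Q_def by blast
    have "v + l \<le> j + floor_log2 (n choose ones n i)" using l(4) le by linarith
    with i j l show ?thesis unfolding Q_def by blast
  qed
  have N_iff: "v \<le> N n w s \<longleftrightarrow> v = 0 \<or> v \<le> s \<and> Q n w v s" for n w v s
    unfolding N_def by (rule le_stage_count_iff) (rule Q_antimono)
  have Q_mono: "Q n w v t" if Q: "Q n w v s" and le: "s \<le> t" for n w v s t
  proof -
    obtain i j l u where i: "i < 2 ^ n" "word_code n i = w" and j: "j < Suc (G n (ones n i) s)"
      and l: "l < Suc s" "u < 2 ^ l"
      "fuel_run0 a s (prod_encode (word_code l u, cond n (ones n i) j)) = Suc (prod_encode (0, w))"
      "v + l \<le> j + floor_log2 (n choose ones n i)"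
      using Q unfolding Q_def by blast
    have "G n (ones n i) s \<le> G n (ones n i) t" using mono le by (rule monoD)
    then have "j < Suc (G n (ones n i) t)" "l < Suc t" using j l(1) le by linarith+
    with i l fuel_run0_mono[OF l(3) le] show ?thesis unfolding Q_def by blast
  qed
  have N_mono: "mono (N n w)" for n w
  proof (rule monoI)
    fix s t :: nat assume "s \<le> t"
    have "N n w s \<le> N n w s" ..
    then show "N n w s \<le> N n w t" using \<open>s \<le> t\<close> unfolding N_iff by (meson Q_mono order_trans)
  qed
  have N_comp: "computable (\<lambda>z. N (pfst z) (pfst (psnd z)) (psnd (psnd z)))"
  proof -
    have "computable (\<lambda>x. stage_count ((\<lambda>nw. Q (pfst nw) (psnd nw)) (prod_encode (pfst x, pfst (psnd x)))) (psnd (psnd x)))"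
    proof (rule computable_stage_count)
      show "decidable (\<lambda>z. Q (pfst (pfst z)) (psnd (pfst z)) (pfst (psnd z)) (psnd (psnd z)))"
        unfolding Q_def cond_def shifted_encode_def
        by (intro computable_intros computable_comp3[OF G])
    qed (intro computable_intros)+
    then show ?thesis by (simp add: N_def)
  qed
  define y where "y n k j = NatSeq [n, k, int_encode (int j - int c)]" for n k j
  have sound: "\<exists>j\<le>g n (count_list x True). \<exists>q. A q (y n (count_list x True) j) = Some (Word x) \<and>
      v + length q \<le> j + floor_log2 (n choose count_list x True)"
    if n: "0 < n" and x: "length x = n" and v: "v \<le> N n (encode_word x) s" "0 < v" for n x v s
  proof -
    let ?k = "count_list x True"
    have k: "?k \<le> n" using x count_le_length by metis
    have "Q n (encode_word x) v s" using v N_iff by auto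
    then obtain j q where jq: "j \<le> G n ?k s"
      "fuel_run0 a s (prod_encode (encode_word q, cond n ?k j)) = Suc (encode_obj (Word x))"
      "v + length q \<le> j + floor_log2 (n choose ?k)"
      unfolding Q_words[OF x] by blast
    have "run a (\<lambda>_. 0) (prod_encode (encode_word q, encode_obj (y n ?k j))) = Some (encode_obj (Word x))"
      using jq(2) unfolding run_iff_fuel_run0 cond y_def by blast
    then obtain o' where o': "A q (y n ?k j) = Some o'" "encode_obj o' = encode_obj (Word x)"
      unfolding a by blast
    have "o' = Word x" using o'(2) by (cases o') auto
    moreover have "j \<le> g n ?k" using jq(1) G_le[OF n k] order_trans by blast
    ultimately show ?thesis using o'(1) jq(3) by blast
  qed
  have N_bound: "N n (encode_word x) s \<le> g n (count_list x True) + floor_log2 (n choose count_list x True)"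
    if "0 < n" "length x = n" for n x s
  proof (cases "N n (encode_word x) s = 0")
    case False
    then show ?thesis using sound[OF that order_refl, of s] by force
  qed simp
  define L where "L n w = Max (range (N n w))" for n w
  have L: "N n (encode_word x) s \<le> L n (encode_word x)" "\<exists>s. N n (encode_word x) s = L n (encode_word x)"
    if "0 < n" "length x = n" for n x s
    unfolding L_def using mono_bounded_Max[of "N n (encode_word x)", OF N_bound[OF that]] by auto
  have L_ge: "g n k + floor_log2 (n choose k) \<le> L n (encode_word x) + length q"
    if n: "0 < n" and x: "length x = n" and k: "k = count_list x True"
      and q: "A q (y n k (g n k)) = Some (Word x)" for n x k q
  proof (cases "g n k + floor_log2 (n choose k) \<le> length q")
    case False
    define v where "v = g n k + floor_log2 (n choose k) - length q"
    have "k \<le> n" using x k count_le_length by metis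
    then obtain s where s: "G n k s = g n k" using G_eq[OF n] by blast
    have "run a (\<lambda>_. 0) (prod_encode (encode_word q, cond n k (g n k))) = Some (encode_obj (Word x))"
      using q unfolding cond a y_def[symmetric] by simp
    then obtain t where t: "fuel_run0 a t (prod_encode (encode_word q, cond n k (g n k))) = Suc (encode_obj (Word x))"
      unfolding run_iff_fuel_run0 by blast
    define r where "r = s + t + length q + v"
    have "G n k s \<le> G n k r" using mono[of n k] by (rule monoD) (simp add: r_def)
    moreover have "fuel_run0 a r (prod_encode (encode_word q, cond n k (g n k))) = Suc (encode_obj (Word x))"
      using t by (rule fuel_run0_mono) (simp add: r_def)
    ultimately have "Q n (encode_word x) v r"
      unfolding Q_words[OF x] k[symmetric] using s False
      by (intro exI[of _ "g n k"] exI[of _ q] conjI) (auto simp: r_def v_def)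
    then have "v \<le> N n (encode_word x) r" unfolding N_iff by (simp add: r_def)
    also have "\<dots> \<le> L n (encode_word x)" by (rule L(1)[OF n x])
    finally show ?thesis unfolding v_def by simp
  qed simp
  have L_weight: "(2::real) ^ L n (encode_word x) \<le> 1 +
      (\<Sum>j<Suc (g n k). 2 ^ j * 2 ^ floor_log2 (n choose k) * complexity_weight A (Word x) (y n k j))"
    if n: "0 < n" and x: "x \<in> words n k" for n k x
  proof (cases "L n (encode_word x) = 0")
    case True
    then show ?thesis
      by (auto intro!: add_nonneg_nonneg sum_nonneg mult_nonneg_nonneg complexity_weight_nonneg)
  next
    case False
    have len: "length x = n" "count_list x True = k" using x by (auto simp: words_def)
    let ?t = "\<lambda>j. (2::real) ^ j * 2 ^ floor_log2 (n choose k) * complexity_weight A (Word x) (y n k j)"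
    have nonneg: "0 \<le> ?t j" for j by (intro mult_nonneg_nonneg complexity_weight_nonneg) auto
    obtain s where "N n (encode_word x) s = L n (encode_word x)" using L(2)[OF n len(1)] by blast
    then obtain j q where jq: "j \<le> g n k" "A q (y n k j) = Some (Word x)"
      "L n (encode_word x) + length q \<le> j + floor_log2 (n choose k)"
      using sound[OF n len(1), of "L n (encode_word x)" s] False len(2) by auto
    obtain m where m: "complexity A (Word x) (y n k j) = enat m" "m \<le> length q"
      using complexity_le[of A, OF jq(2)] enat_ile by fastforce
    have "(2::real) ^ (L n (encode_word x) + m) \<le> 2 ^ (j + floor_log2 (n choose k))"
      using jq(3) m(2) by (intro power_increasing) auto
    then have "(2::real) ^ L n (encode_word x) \<le> ?t j"
      by (simp add: complexity_weight_def m(1) power_add field_simps)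
    also have "\<dots> \<le> (\<Sum>j<Suc (g n k). ?t j)"
      using jq(1) nonneg by (intro member_le_sum) auto
    finally show ?thesis by simp
  qed
  have mean_words: "(\<Sum>x\<in>words n k. 2 powr (real (L n (encode_word x)) - real (c + 2))) / real (n choose k)
      \<le> 2 powr (real (g n k) - real c)" if n: "0 < n" and k: "k \<le> n" for n k
  proof -
    let ?C = "real (n choose k)" and ?f = "floor_log2 (n choose k)"
    have pos: "0 < n choose k" using k by simp
    have f: "(2::real) ^ ?f \<le> ?C"
    proof -
      have "real (2 ^ ?f) \<le> real (n choose k)"
        using floor_log2_bounds(1)[OF pos] by (subst of_nat_le_iff)
      then show ?thesis by simp
    qed
    have "(\<Sum>x\<in>words n k. (2::real) ^ L n (encode_word x)) \<le> (\<Sum>x\<in>words n k. 1 +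
      (\<Sum>j<Suc (g n k). 2 ^ j * 2 ^ ?f * complexity_weight A (Word x) (y n k j)))"
      by (intro sum_mono L_weight n)
    also have "\<dots> = ?C + (\<Sum>j<Suc (g n k). 2 ^ j * 2 ^ ?f * (\<Sum>x\<in>words n k. complexity_weight A (Word x) (y n k j)))"
      unfolding sum.distrib sum_distrib_left
      by (subst (2) sum.swap) (simp add: card_words)
    also have "\<dots> \<le> ?C + (\<Sum>j<Suc (g n k). 2 ^ j * ?C * 1)"
    proof (intro add_left_mono sum_mono mult_mono)
      fix j
      have "(\<Sum>x\<in>words n k. complexity_weight A (Word x) (y n k j))
          = (\<Sum>x\<in>Word ` words n k. complexity_weight A x (y n k j))"
        by (subst sum.reindex) (auto simp: inj_on_def)
      also have "\<dots> \<le> 1" by (rule sum_complexity_weight_le_1[OF A]) simp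
      finally show "(\<Sum>x\<in>words n k. complexity_weight A (Word x) (y n k j)) \<le> 1" .
    qed (use f in \<open>auto intro: sum_nonneg complexity_weight_nonneg\<close>)
    also have "\<dots> = ?C * (1 + (\<Sum>j<Suc (g n k). 2 ^ j))"
      by (simp add: sum_distrib_left sum_distrib_right algebra_simps)
    also have "\<dots> \<le> ?C * (2 ^ Suc (g n k) + 2 ^ Suc (g n k))"
      using sum_power2_le[of "g n k"] one_le_power[of "2::real" "Suc (g n k)"]
      by (intro mult_left_mono add_mono) simp_all
    also have "\<dots> = ?C * 2 ^ (g n k + 2)" by simp
    finally have sum_le: "(\<Sum>x\<in>words n k. (2::real) ^ L n (encode_word x)) \<le> ?C * 2 ^ (g n k + 2)" .
    have "(\<Sum>x\<in>words n k. 2 powr (real (L n (encode_word x)) - real (c + 2)))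
        = (\<Sum>x\<in>words n k. 2 ^ L n (encode_word x)) / 2 ^ (c + 2)"
      unfolding sum_divide_distrib powr_diff by (simp add: powr_realpow powr_add)
    also have "\<dots> \<le> ?C * 2 ^ (g n k + 2) / 2 ^ (c + 2)"
      using sum_le by (intro divide_right_mono) auto
    also have "\<dots> = ?C * 2 powr (real (g n k) - real c)"
      by (simp add: powr_diff powr_realpow power_add)
    finally show ?thesis using pos by (simp add: field_simps)
  qed
  have "is_test (\<lambda>n. {x. length x = n}) bernoulli_measure encode_word
    (\<lambda>n p x. ereal (real (Max (range (N n (encode_word x)))) - real (c + 2)))"
  proof (rule is_test_of_stages[OF N_comp N_mono])
    show "N n (encode_word x) s \<le> g n (count_list x True) + floor_log2 (n choose count_list x True)"
      if "0 < n" "x \<in> {x. length x = n}" for n x s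
      using that N_bound by simp
    fix n :: nat and p :: real assume n: "0 < n" and p: "p \<in> {0..1}"
    have "(\<integral>\<^sup>+x. ennreal (2 powr (real (L n (encode_word x)) - real (c + 2))) \<partial>measure_pmf (bernoulli_measure n p))
      = ennreal (\<Sum>k\<le>n. pmf (binomial_pmf n p) k *
          ((\<Sum>x\<in>words n k. 2 powr (real (L n (encode_word x)) - real (c + 2))) / real (n choose k)))"
      by (rule nn_integral_bernoulli[OF p]) simp
    also have "\<dots> \<le> ennreal (\<Sum>k\<le>n. pmf (binomial_pmf n p) k * 2 powr (real (g n k) - real c))"
      using mean_words[OF n] by (intro ennreal_leI sum_mono mult_left_mono) auto
    also have "\<dots> = (\<integral>\<^sup>+k. ennreal (2 powr (real (g n k) - real c)) \<partial>measure_pmf (binomial_pmf n p))"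
      by (rule nn_integral_binomial[OF p, symmetric]) simp
    also have "\<dots> \<le> (\<integral>\<^sup>+k. exp2 (D' n p k) \<partial>measure_pmf (binomial_pmf n p))"
    proof (rule nn_integral_mono_AE, rule AE_pmfI)
      fix k assume "k \<in> set_pmf (binomial_pmf n p)"
      then have "k \<le> n" using p set_pmf_binomial_eq[of p n] by (auto split: if_splits)
      from g[OF n p this] show "ennreal (2 powr (real (g n k) - real c)) \<le> exp2 (D' n p k)"
        by (cases "D' n p k") (auto simp: exp2_def intro!: ennreal_leI)
    qed
    also have "\<dots> \<le> 1" using D' n p unfolding is_test_def by blast
    finally show "(\<integral>\<^sup>+x. ennreal (2 powr (real (Max (range (N n (encode_word x)))) - real (c + 2)))
        \<partial>measure_pmf (bernoulli_measure n p)) \<le> 1"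
      unfolding L_def .
  qed
  then show ?thesis
  proof (rule that)
    fix n :: nat and p :: real and x q
    assume "0 < n" "length x = n"
      "A q (NatSeq [n, count_list x True, int_encode (int (g n (count_list x True)) - int c)]) = Some (Word x)"
    then have "g n (count_list x True) + floor_log2 (n choose count_list x True) \<le> L n (encode_word x) + length q"
      by (intro L_ge) (auto simp: y_def)
    then have "real (g n (count_list x True)) + real (floor_log2 (n choose count_list x True))
        \<le> real (L n (encode_word x)) + real (length q)"
      by linarith
    then show "ereal (real (g n (count_list x True)) + real (floor_log2 (n choose count_list x True))
        - real (length q) - real (c + 2)) \<le> ereal (real (Max (range (N n (encode_word x)))) - real (c + 2))"
      unfolding L_def by simp
  qed
qed

section \<open>Upper bound for the Bernoulli deficiency\<close>

text \<open>
  Here \<open>g\<close> is the Bernoulli deficiency shifted by \<open>c\<close>, and \<open>u n k\<close> is the integer part of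
  the logarithm of the average of \<open>2 ^ g\<close> over the words with \<open>k\<close> ones. The mean of \<open>2 ^ u\<close>
  is bounded because averaging over these words and then over \<open>k\<close> is taking the mean under the Bernoulli
  measure.
\<close>

theorem averaged_weights_test:
  assumes D: "is_test (\<lambda>n. {x. length x = n}) bernoulli_measure encode_word D"
    and G: "computable (\<lambda>z. G (pfst z) (pfst (psnd z)) (psnd (psnd z)))"
    and mono: "\<And>n a. mono (G n a)"
    and G_le: "\<And>n x s. 0 < n \<Longrightarrow> length x = n \<Longrightarrow> G n (encode_word x) s \<le> g n x"
    and g: "\<And>n p x. 0 < n \<Longrightarrow> p \<in> {0..1} \<Longrightarrow> length x = n \<Longrightarrow> ereal (real (g n x) - real c) \<le> D n p x"
  obtains u :: "nat \<Rightarrow> nat \<Rightarrow> nat" where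
    "is_test (\<lambda>n. {0..n}) binomial_pmf (\<lambda>k. k) (\<lambda>n p k. ereal (real (u n k) - real c))"
    and "\<And>n k s. 0 < n \<Longrightarrow> k \<le> n \<Longrightarrow>
      (\<Sum>x\<in>words n k. 2 ^ G n (encode_word x) s) \<le> 2 ^ Suc (u n k) * (n choose k)"
proof -
  define Q where "Q n k v s \<longleftrightarrow> 2 ^ v * (n choose k)
      \<le> (\<Sum>i<2 ^ n. if ones n i = k then 2 ^ G n (word_code n i) s else 0)" for n k v s
  define U where "U n k s = stage_count (Q n k) s" for n k s
  define u where "u n k = Max (range (U n k))" for n k
  have Q_iff: "Q n k v s \<longleftrightarrow> 2 ^ v * (n choose k) \<le> (\<Sum>x\<in>words n k. 2 ^ G n (encode_word x) s)" for n k v s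
    unfolding Q_def sum_words word_code_eq ..
  have U_iff: "v \<le> U n k s \<longleftrightarrow> v = 0 \<or> v \<le> s \<and> Q n k v s" for n k v s
    unfolding U_def
  proof (rule le_stage_count_iff)
    fix v w assume "v \<le> w" "Q n k w s"
    have "(2::nat) ^ v * (n choose k) \<le> 2 ^ w * (n choose k)" using \<open>v \<le> w\<close> by simp
    with \<open>Q n k w s\<close> show "Q n k v s" unfolding Q_def by linarith
  qed
  have Q_mono: "Q n k v t" if Q: "Q n k v s" and le: "s \<le> t" for n k v s t
  proof -
    have "G n a s \<le> G n a t" for a using mono le by (rule monoD)
    then have "(\<Sum>x\<in>words n k. 2 ^ G n (encode_word x) s) \<le> (\<Sum>x\<in>words n k. (2::nat) ^ G n (encode_word x) t)"
      by (intro sum_mono power_increasing) auto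
    with Q show ?thesis unfolding Q_iff by linarith
  qed
  have U_mono: "mono (U n k)" for n k
  proof (rule monoI)
    fix s t :: nat assume "s \<le> t"
    have "U n k s \<le> U n k s" ..
    then show "U n k s \<le> U n k t" using \<open>s \<le> t\<close> unfolding U_iff by (meson Q_mono order_trans)
  qed
  have U_comp: "computable (\<lambda>z. U (pfst z) (pfst (psnd z)) (psnd (psnd z)))"
  proof -
    have "computable (\<lambda>x. stage_count ((\<lambda>nk. Q (pfst nk) (psnd nk)) (prod_encode (pfst x, pfst (psnd x)))) (psnd (psnd x)))"
    proof (rule computable_stage_count)
      show "decidable (\<lambda>z. Q (pfst (pfst z)) (psnd (pfst z)) (pfst (psnd z)) (psnd (psnd z)))"
        unfolding Q_def by (intro computable_intros computable_comp3[OF G])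
    qed (intro computable_intros)+
    then show ?thesis by (simp add: U_def)
  qed
  have U_le: "2 ^ U n k s * (n choose k) \<le> (\<Sum>x\<in>words n k. 2 ^ g n x)" if n: "0 < n" for n k s
  proof (cases "U n k s = 0")
    case True
    have "(\<Sum>x\<in>words n k. 1) \<le> (\<Sum>x\<in>words n k. (2::nat) ^ g n x)" by (intro sum_mono) simp
    then show ?thesis by (simp add: True card_words)
  next
    case False
    then have "Q n k (U n k s) s" using U_iff[of "U n k s" n k s] by simp
    then have "2 ^ U n k s * (n choose k) \<le> (\<Sum>x\<in>words n k. 2 ^ G n (encode_word x) s)"
      unfolding Q_iff .
    also have "(\<Sum>x\<in>words n k. 2 ^ G n (encode_word x) s) \<le> (\<Sum>x\<in>words n k. (2::nat) ^ g n x)"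
      using G_le[OF n] by (intro sum_mono power_increasing) (auto simp: words_def)
    finally show ?thesis .
  qed
  have U_bound: "U n k s \<le> (\<Sum>x\<in>words n k. 2 ^ g n x)" if n: "0 < n" and k: "k \<le> n" for n k s
  proof -
    have "U n k s < 2 ^ U n k s" by (rule less_exp)
    also have "\<dots> \<le> 2 ^ U n k s * (n choose k)" using k by (simp add: Suc_leI)
    finally show ?thesis using U_le[OF n, of k s] by simp
  qed
  have u: "U n k s \<le> u n k" "\<exists>s. U n k s = u n k" if "0 < n" "k \<le> n" for n k s
    unfolding u_def using mono_bounded_Max[of "U n k", OF U_bound[OF that]] by auto
  have "is_test (\<lambda>n. {0..n}) binomial_pmf (\<lambda>k. k) (\<lambda>n p k. ereal (real (Max (range (U n k))) - real c))"
  proof (rule is_test_of_stages[where e = "\<lambda>k. k", OF U_comp U_mono])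
    show "U n k s \<le> (\<Sum>x\<in>words n k. 2 ^ g n x)" if "0 < n" "k \<in> {0..n}" for n k s
      using that by (intro U_bound) auto
    fix n :: nat and p :: real assume n: "0 < n" and p: "p \<in> {0..1}"
    have average: "2 powr (real (u n k) - real c)
        \<le> (\<Sum>x\<in>words n k. 2 powr (real (g n x) - real c)) / real (n choose k)" if k: "k \<le> n" for k
    proof -
      obtain s where "U n k s = u n k" using u(2)[OF n k] by blast
      then have "2 ^ u n k * (n choose k) \<le> (\<Sum>x\<in>words n k. 2 ^ g n x)"
        using U_le[OF n, of k s] by simp
      then have "real (2 ^ u n k * (n choose k)) \<le> real (\<Sum>x\<in>words n k. 2 ^ g n x)"
        by (subst of_nat_le_iff)
      then have "2 ^ u n k * real (n choose k) / 2 ^ c \<le> (\<Sum>x\<in>words n k. 2 ^ g n x) / 2 ^ c"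
        by (intro divide_right_mono) auto
      also have "\<dots> = (\<Sum>x\<in>words n k. 2 powr (real (g n x) - real c))"
        unfolding sum_divide_distrib by (simp add: powr_diff powr_realpow)
      finally show ?thesis using k by (simp add: powr_diff powr_realpow field_simps)
    qed
    have "(\<integral>\<^sup>+k. ennreal (2 powr (real (u n k) - real c)) \<partial>measure_pmf (binomial_pmf n p))
      = ennreal (\<Sum>k\<le>n. pmf (binomial_pmf n p) k * 2 powr (real (u n k) - real c))"
      by (rule nn_integral_binomial[OF p]) simp
    also have "\<dots> \<le> ennreal (\<Sum>k\<le>n. pmf (binomial_pmf n p) k *
          ((\<Sum>x\<in>words n k. 2 powr (real (g n x) - real c)) / real (n choose k)))"
      using average by (intro ennreal_leI sum_mono mult_left_mono) auto
    also have "\<dots> = (\<integral>\<^sup>+x. ennreal (2 powr (real (g n x) - real c)) \<partial>measure_pmf (bernoulli_measure n p))"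
      by (rule nn_integral_bernoulli[OF p, symmetric]) simp
    also have "\<dots> \<le> (\<integral>\<^sup>+x. exp2 (D n p x) \<partial>measure_pmf (bernoulli_measure n p))"
    proof (rule nn_integral_mono_AE, rule AE_pmfI)
      fix x assume "x \<in> set_pmf (bernoulli_measure n p)"
      then have "length x = n" by (simp add: bernoulli_measure_def set_replicate_pmf)
      from g[OF n p this] show "ennreal (2 powr (real (g n x) - real c)) \<le> exp2 (D n p x)"
        by (cases "D n p x") (auto simp: exp2_def intro!: ennreal_leI)
    qed
    also have "\<dots> \<le> 1" using D n p unfolding is_test_def by blast
    finally show "(\<integral>\<^sup>+k. ennreal (2 powr (real (Max (range (U n k))) - real c))
        \<partial>measure_pmf (binomial_pmf n p)) \<le> 1"
      unfolding u_def .
  qed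
  then have "is_test (\<lambda>n. {0..n}) binomial_pmf (\<lambda>k. k) (\<lambda>n p k. ereal (real (u n k) - real c))"
    unfolding u_def .
  then show ?thesis
  proof (rule that)
    fix n k s :: nat assume n: "0 < n" and k: "k \<le> n"
    show "(\<Sum>x\<in>words n k. 2 ^ G n (encode_word x) s) \<le> 2 ^ Suc (u n k) * (n choose k)"
    proof (rule ccontr)
      assume "\<not> ?thesis"
      then have "Q n k (Suc (u n k)) s" unfolding Q_iff by linarith
      then have "Q n k (Suc (u n k)) (max s (Suc (u n k)))" by (rule Q_mono) simp
      then have "Suc (u n k) \<le> U n k (max s (Suc (u n k)))" unfolding U_iff by simp
      also have "\<dots> \<le> u n k" by (rule u(1)[OF n k])
      finally show False by simp
    qed
  qed
qed

section \<open>The deficiency of Bernoulli sequences\<close>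

lemma ex_positive_bernoulli:
  assumes "0 < n" "length x = n"
  shows "\<exists>p\<in>{0..1}. 0 < pmf (bernoulli_measure n p) x"
proof -
  let ?k = "count_list x True"
  have k: "?k \<le> n" using assms(2) count_le_length by metis
  obtain p where p: "p \<in> {0..1}" "0 < pmf (binomial_pmf n p) ?k"
    using ex_positive_binomial[OF assms(1) k] by blast
  have "x \<in> words n ?k" using assms(2) by (simp add: words_def)
  from pmf_bernoulli_measure_eq_binomial[OF p(1) this]
  have "pmf (bernoulli_measure n p) x = pmf (binomial_pmf n p) ?k / real (n choose ?k)" .
  moreover have "0 < real (n choose ?k)" using k by simp
  with p(2) have "0 < pmf (binomial_pmf n p) ?k / real (n choose ?k)" by (rule divide_pos_pos)
  ultimately have "0 < pmf (bernoulli_measure n p) x" by (simp only:)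
  with p(1) show ?thesis by blast
qed

theorem theorem1:
  fixes A :: method_fun and D :: "bool list test" and D' :: "nat test"
  assumes "optimal_prefix_method A"
    and "universal_bernoulli_test D"
    and "universal_binomial_test D'"
  shows "\<exists>C::real. \<forall>n>0. \<forall>x :: bool list. length x = n \<longrightarrow>
    (let k = count_list x True;
         d = binomial_deficiency D' n k
     in \<bar>bernoulli_deficiency D x
          - (ereal (log 2 (real (n choose k)))
             - ereal_of_enat (complexity A (Word x) (condition_obj n k d)))
          - d\<bar> \<le> ereal C)"
proof -
  have A: "prefix_method A" using assms(1) unfolding optimal_prefix_method_def by blast
  have D: "universal_test (\<lambda>n. {x. length x = n}) bernoulli_measure encode_word D"
    using assms(2) unfolding universal_bernoulli_test_def .
  have D': "universal_test (\<lambda>n. {0..n}) binomial_pmf (\<lambda>k. k) D'"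
    using assms(3) unfolding universal_binomial_test_def .
  have tests: "is_test (\<lambda>n. {x. length x = n}) bernoulli_measure encode_word D"
      "is_test (\<lambda>n. {0..n}) binomial_pmf (\<lambda>k. k) D'"
    using D D' unfolding universal_test_def by blast+
  have universal:
      "is_test (\<lambda>n. {x. length x = n}) bernoulli_measure encode_word T \<Longrightarrow>
        \<exists>C::real. \<forall>n>0. \<forall>p\<in>{0..1}. \<forall>x\<in>{x. length x = n}. T n p x - ereal C \<le> D n p x"
      "is_test (\<lambda>n. {0..n}) binomial_pmf (\<lambda>k. k) T' \<Longrightarrow>
        \<exists>C::real. \<forall>n>0. \<forall>p\<in>{0..1}. \<forall>k\<in>{0..n}. T' n p k - ereal C \<le> D' n p k" for T T'
    using D D' unfolding universal_test_def by blast+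

  \<comment> \<open>\<open>g - a\<close> and \<open>g' - b\<close> are the two deficiencies, with stages \<open>G\<close> and \<open>G'\<close>\<close>
  obtain G g a where G: "computable (\<lambda>z. G (pfst z) (pfst (psnd z)) (psnd (psnd z)))"
      "\<And>n w. mono (G n w)"
    and g: "\<And>n x. 0 < n \<Longrightarrow> x \<in> {x. length x = n} \<Longrightarrow>
        (INF p\<in>{0..1}. D n p x) = ereal (real (g n x) - real a)"
      "\<And>n x s. 0 < n \<Longrightarrow> x \<in> {x. length x = n} \<Longrightarrow> G n (encode_word x) s \<le> g n x"
      "\<And>n x. 0 < n \<Longrightarrow> x \<in> {x. length x = n} \<Longrightarrow> \<exists>s. G n (encode_word x) s = g n x"
    using ex_positive_bernoulli by (rule inf_of_universal_test[OF D]) blast+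
  obtain G' g' b where G': "computable (\<lambda>z. G' (pfst z) (pfst (psnd z)) (psnd (psnd z)))"
      "\<And>n k. mono (G' n k)"
    and g': "\<And>n k. 0 < n \<Longrightarrow> k \<in> {0..n} \<Longrightarrow> (INF p\<in>{0..1}. D' n p k) = ereal (real (g' n k) - real b)"
      "\<And>n k s. 0 < n \<Longrightarrow> k \<in> {0..n} \<Longrightarrow> G' n k s \<le> g' n k"
      "\<And>n k. 0 < n \<Longrightarrow> k \<in> {0..n} \<Longrightarrow> \<exists>s. G' n k s = g' n k"
    using ex_positive_binomial by (rule inf_of_universal_test[OF D']) auto
  have g_le: "ereal (real (g n x) - real a) \<le> D n p x"
    if "0 < n" "p \<in> {0..1}" "length x = n" for n p x
  proof -
    have "(INF p\<in>{0..1}. D n p x) \<le> D n p x" using that(2) by (rule INF_lower)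
    then show ?thesis using g(1) that by simp
  qed
  have g'_le: "ereal (real (g' n k) - real b) \<le> D' n p k"
    if "0 < n" "p \<in> {0..1}" "k \<le> n" for n p k
  proof -
    have "(INF p\<in>{0..1}. D' n p k) \<le> D' n p k" using that(2) by (rule INF_lower)
    then show ?thesis using g'(1) that by simp
  qed

  have G_le: "G n (encode_word x) s \<le> g n x" if "0 < n" "length x = n" for n x s
    using g(2) that by simp
  have G'_le: "G' n k s \<le> g' n k" if "0 < n" "k \<le> n" for n k s
    using g'(2) that by simp
  have G'_eq: "\<exists>s. G' n k s = g' n k" if "0 < n" "k \<le> n" for n k
    using g'(3) that by simp

  obtain T where T: "is_test (\<lambda>n. {x. length x = n}) bernoulli_measure encode_word T"
    and T_ge: "\<And>n p x q. 0 < n \<Longrightarrow> length x = n \<Longrightarrow>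
      A q (NatSeq [n, count_list x True, int_encode (int (g' n (count_list x True)) - int b)]) = Some (Word x) \<Longrightarrow>
      ereal (real (g' n (count_list x True)) + real (floor_log2 (n choose count_list x True))
        - real (length q) - real (b + 2)) \<le> T n p x"
    by (rule described_words_test[where g = g' and c = b, OF A tests(2) G' G'_le G'_eq g'_le])
      (assumption | rule that | blast)+
  obtain B :: real where B: "\<And>n p x. 0 < n \<Longrightarrow> p \<in> {0..1} \<Longrightarrow> length x = n \<Longrightarrow> T n p x - ereal B \<le> D n p x"
    using universal(1)[OF T] by blast

  obtain u where u: "is_test (\<lambda>n. {0..n}) binomial_pmf (\<lambda>k. k) (\<lambda>n p k. ereal (real (u n k) - real a))"
    and u_ge: "\<And>n k s. 0 < n \<Longrightarrow> k \<le> n \<Longrightarrow>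
      (\<Sum>x\<in>words n k. 2 ^ G n (encode_word x) s) \<le> 2 ^ Suc (u n k) * (n choose k)"
    by (rule averaged_weights_test[where g = g and c = a, OF tests(1) G G_le g_le])
      (assumption | rule that | blast)+
  obtain B' :: real where B': "\<forall>n>0. \<forall>p\<in>{0..1}. \<forall>k\<in>{0..n}.
      ereal (real (u n k) - real a) - ereal B' \<le> D' n p k"
    using universal(2)[OF u] by blast
  \<comment> \<open>by \<open>u_le\<close>, the normalising exponent \<open>g' n k + K\<close> is large enough for the interval code\<close>
  define K where "K = a + nat \<lceil>B'\<rceil> + 1"
  have u_le: "Suc (u n k) \<le> g' n k + K" if n: "0 < n" and k: "k \<le> n" for n k
  proof -
    have "ereal (real (u n k) - real a - B') \<le> (INF p\<in>{0..1}. D' n p k)"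
      using B' n k by (intro INF_greatest) simp
    then have "real (u n k) - real a - B' \<le> real (g' n k) - real b" using g'(1)[OF n] k by simp
    then show ?thesis unfolding K_def by linarith
  qed
  obtain C where C: "\<And>n k d x s. x \<in> words n k \<Longrightarrow>
    \<forall>s. (\<Sum>x\<in>words n k. 2 ^ G n (encode_word x) s) \<le> 2 ^ (shifted_value b d + K) * (n choose k) \<Longrightarrow>
    \<exists>l. complexity A (Word x) (NatSeq [n, k, d]) = enat l \<and>
      l + G n (encode_word x) s \<le> shifted_value b d + floor_log2 (n choose k) + C"
    using complexity_le_of_summable_stages[where c = b and K = K, OF assms(1) G] by blast

  have "\<bar>bernoulli_deficiency D x
          - (ereal (log 2 (real (n choose k)))
             - ereal_of_enat (complexity A (Word x) (condition_obj n k d)))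
          - d\<bar> \<le> ereal (real C + real b + 3 + \<bar>B\<bar>)"
    if n: "0 < n" and x: "length x = n" and k_def: "k = count_list x True"
      and d_def: "d = binomial_deficiency D' n k" for n x k d
  proof -
    have k: "k \<le> n" using x k_def count_le_length by metis
    define e where "e = int_encode (int (g' n k) - int b)"
    let ?f = "floor_log2 (n choose k)"
    have d: "d = ereal (real (g' n k) - real b)"
      using g'(1)[OF n] k by (simp add: d_def binomial_deficiency_def)
    have "\<lfloor>real (g' n k) - real b\<rfloor> = int (g' n k) - int b" by linarith
    then have cond: "condition_obj n k d = NatSeq [n, k, e]"
      by (simp add: condition_obj_def d e_def)
    have shift: "shifted_value b e = g' n k" by (simp add: e_def shifted_value_int_encode)
    have xw: "x \<in> words n k" using x k_def by (simp add: words_def)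
    obtain s where s: "G n (encode_word x) s = g n x" using g(3)[OF n] x by blast
    have "(\<Sum>x\<in>words n k. 2 ^ G n (encode_word x) s) \<le> 2 ^ (shifted_value b e + K) * (n choose k)" for s
    proof -
      have "(2::nat) ^ Suc (u n k) * (n choose k) \<le> 2 ^ (shifted_value b e + K) * (n choose k)"
        using u_le[OF n k] unfolding shift by (intro mult_right_mono power_increasing) auto
      then show ?thesis using u_ge[OF n k, of s] by (rule order_trans[rotated])
    qed
    then obtain l where l: "complexity A (Word x) (NatSeq [n, k, e]) = enat l"
      "l + g n x \<le> g' n k + ?f + C"
      using C[OF xw, of e s] unfolding s shift by blast
    obtain q where q: "A q (NatSeq [n, k, e]) = Some (Word x)" "length q = l"
      using complexity_attained[OF l(1)] by blast
    have "ereal (real (g' n k) + real ?f - real l - real (b + 2) - B) \<le> (INF p\<in>{0..1}. D n p x)"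
    proof (rule INF_greatest)
      fix p :: real assume p: "p \<in> {0..1}"
      have "ereal (real (g' n k) + real ?f - real l - real (b + 2)) \<le> T n p x"
        using T_ge[OF n x, of q p] q unfolding k_def e_def by simp
      then have "ereal (real (g' n k) + real ?f - real l - real (b + 2)) - ereal B \<le> T n p x - ereal B"
        by (intro ereal_minus_mono) auto
      also have "\<dots> \<le> D n p x" by (rule B[OF n p x])
      finally show "ereal (real (g' n k) + real ?f - real l - real (b + 2) - B) \<le> D n p x" by simp
    qed
    then have lower: "real (g' n k) + real ?f - real l - real (b + 2) - B \<le> real (g n x) - real a"
      using g(1)[OF n] x by simp
    have upper: "real l + real (g n x) \<le> real (g' n k) + real ?f + real C" using l(2) by linarith
    have pos: "0 < n choose k" using k by simp
    have "real (2 ^ ?f) \<le> real (n choose k)" "real (n choose k) \<le> real (2 ^ Suc ?f)"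
      using floor_log2_bounds[OF pos] by (simp_all only: of_nat_le_iff less_imp_le)
    then have log: "real ?f \<le> log 2 (real (n choose k))" "log 2 (real (n choose k)) \<le> real ?f + 1"
      using pos by (auto simp: le_log_iff log_le_iff powr_realpow powr_add)
    have "bernoulli_deficiency D x = ereal (real (g n x) - real a)"
      using g(1)[OF n] x by (simp add: bernoulli_deficiency_def)
    moreover have "complexity A (Word x) (condition_obj n k d) = enat l" using cond l(1) by simp
    ultimately have "\<bar>bernoulli_deficiency D x - (ereal (log 2 (real (n choose k)))
          - ereal_of_enat (complexity A (Word x) (condition_obj n k d))) - d\<bar>
        = ereal \<bar>real (g n x) - real a - (log 2 (real (n choose k)) - real l) - (real (g' n k) - real b)\<bar>"
      using d by simp
    also have "\<dots> \<le> ereal (real C + real b + 3 + \<bar>B\<bar>)"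
    proof -
      have "real (b + 2) = real b + 2" "0 \<le> real a" "0 \<le> real b" "0 \<le> real C" by simp_all
      with lower upper log show ?thesis unfolding ereal_less_eq abs_le_iff by linarith
    qed
    finally show ?thesis .
  qed
  then show ?thesis unfolding Let_def by blast
qed

end
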